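(* Let $k\ge1$ and let $(\Lambda,d)$ be a row-finite, locally convex $k$-graph. Then $\Lambda$ is cofinal if and only if $\widetilde{\Lambda}$ is cofinal.
   Context: **Conventions.** $\mathbb N=\{0,1,2,\dots\}$. $\mathbb N^k$ is an additive monoid with canonical generators $e_1,\dots,e_k$ and coordinatewise order $\le$; $m\wedge n$ and $m\vee n$ are coordinatewise minimum and maximum, also used for elements of $(\mathbb N\cup\{\infty\})^k$; $\infty-n=\infty$ for $n \in \mathbb N$. The operations $\wedge,\vee$ bind more tightly than $+,-$. **$k$-graphs.** A $k$-graph is a countable small category $\Lambda$ with a functor $d:\Lambda\to\mathbb N^k$ ($\mathbb N^k$ viewed as a one-object category under addition), called the degree, with the factorisation property: if $\lambda\in\Lambda$ is a morphism and $d(\lambda)=m+n$, there are unique $\mu,\nu\in\Lambda$ with $d(\mu)=m$, $d(\nu)=n$ and $\lambda=\mu\nu$. Elements of $\Lambda$ are its morphisms (paths); objects are identified with identity morphisms, and the set of these is $\Lambda^0=d^{-1}(0)$ (vertices). $r(\lambda)$ and $s(\lambda)$ denote the codomain and domain of $\lambda$; $\lambda\mu=\lambda\circ\mu$ is defined when $s(\lambda)=r(\mu)$. $\Lambda^n=d^{-1}(n)$. For $E\subseteq\Lambda$ and $v\in\Lambda^0$, $vE=\{\lambda\in E:r(\lambda)=v\}$ and $Ev=\{\lambda\in E:s(\lambda)=v\}$; $v\Lambda w=v\Lambda\cap\Lambda w$. For $0\le m\le n\le d(\lambda)$, $\lambda(m,n)$ is the unique path of degree $n-m$ with $\lambda=\lambda'\lambda(m,n)\lambda'''$,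 $d(\lambda')=m$. $\Lambda$ is row-finite if $v\Lambda^n$ is finite for all $v\in\Lambda^0$, $n\in\mathbb N^k$, and has no sources if all $v\Lambda^n$ are non-empty. $\Lambda$ is locally convex if for distinct $i,j\in\{1,\dots,k\}$ and $\lambda\in\Lambda^{e_i}$, $\mu\in\Lambda^{e_j}$ with $r(\lambda)=r(\mu)$, the sets $s(\lambda)\Lambda^{e_j}$ and $s(\mu)\Lambda^{e_i}$ are non-empty. **Boundary paths.** For $m\in(\mathbb N\cup\{\infty\})^k$, $\Omega_{k,m}$ is the $k$-graph with objects $\{p\in\mathbb N^k:p\le m\}$, morphisms $\{(p,q):p\le q\le m,\ p,q\in\mathbb N^k\}$ with $r(p,q)=p$, $s(p,q)=q$, $(p,q)(q,t)=(p,t)$, and $d(p,q)=q-p$. A boundary path of $\Lambda$ is a degree-preserving functor $x:\Omega_{k,m}\to\Lambda$ such that for all $p\in\mathbb N^k$ with $p\le m$ and all $i$, $p_i=m_i$ implies $x(p)\Lambda^{e_i}=\emptyset$, where $x(p)=x(p,p)$ is the image of the object $p$. Its degree is $d(x)=m$ and its range is $r(x)=x(0)$. If $m=(\infty,\dots,\infty)$, $x$ is an infinite path. $\Lambda^{\le\infty}$ is the set of boundary paths. For $n\in\mathbb N^k$, $n\le d(x)$, $\sigma^n(x)$ is the boundary path of degree $d(x)-n$ given by $\sigma^n(x)(p,q)=x(p+n,q+n)$. For $\lambda\in\Lambda$ with $s(\lambda)=r(x)$, $\lambda x$ is the unique boundary path of degree $d(\lambda)+d(x)$ with $(\lambda x)(0,d(\lambda))=\lambda$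 and $\sigma^{d(\lambda)}(\lambda x)=x$. In a $k$-graph with no sources, all boundary paths are infinite paths. **The graph $\widetilde\Lambda$ (Farthing's construction).** Let $V_\Lambda=\{(x;m):x\in\Lambda^{\le\infty},m\in\mathbb N^k\}$ and $P_\Lambda=\{(x;(m,n)):x\in\Lambda^{\le\infty},m\le n\in\mathbb N^k\}$. Put $(x;m)\sim(y;n)$ iff $x(m\wedge d(x))=y(n\wedge d(y))$ and $m-m\wedge d(x)=n-n\wedge d(y)$. Put $(x;(m,n))\approx(y;(p,q))$ iff $x(m\wedge d(x),n\wedge d(x))=y(p\wedge d(y),q\wedge d(y))$, $m-m\wedge d(x)=p-p\wedge d(y)$, and $n-m=q-p$. These are equivalence relations, with classes $[x;m]$ and $[x;(m,n)]$. $\widetilde\Lambda$ is the category with objects $V_\Lambda/{\sim}$, morphisms $P_\Lambda/{\approx}$, range $[x;(m,n)]\mapsto[x;m]$, source $[x;(m,n)]\mapsto[x;n]$, identities $[x;(m,m)]$, composition $[x;(m,n)]\circ[y;(p,q)]=[x(0,n\wedge d(x))\sigma^{p\wedge d(y)}(y);(m,n+q-p)]$ (when $[x;n]=[y;p]$), and degree $[x;(m,n)]\mapsto n-m$. It is a known result of Farthing that $\widetilde\Lambda$ is a row-finite $k$-graph with no sources. **Cofinality.** A row-finite locally convex $k$-graph $\Gamma$ is cofinal if for each $x\in\Gamma^{\le\infty}$ and $v\in\Gamma^0$ there is $n\in\mathbb N^k$ with $n\le d(x)$ and $v\Gamma x(n)\ne\emptyset$. *)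

theory Defs
  imports
    Main
    "HOL-Library.Function_Algebras"
    "HOL-Library.Extended_Nat"
    "HOL-Library.FuncSet"
    "HOL-Library.Countable_Set"
begin

text \<open>
  The index set \<open>{1,\<dots>,k}\<close> is a finite type \<open>'k\<close> (so that \<open>k \<ge> 1\<close>), the monoid of degrees is
  \<^typ>\<open>'k \<Rightarrow> nat\<close> and extended degrees are \<^typ>\<open>'k \<Rightarrow> enat\<close>. Order, addition and subtraction
  are pointwise; subtraction on \<^typ>\<open>nat\<close> truncates, but below it is only applied to \<open>n - m\<close>
  with \<open>m \<le> n\<close>.
\<close>

type_synonym 'k mdeg = "'k \<Rightarrow> nat"
type_synonym 'k xdeg = "'k \<Rightarrow> enat"

definition emb :: "'k mdeg \<Rightarrow> 'k xdeg" where
  "emb p = (\<lambda>i. enat (p i))"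

text \<open>\<open>m \<and> d\<close> for finite \<open>m\<close> and extended \<open>d\<close>, read back as a finite degree.\<close>

definition meet :: "'k mdeg \<Rightarrow> 'k xdeg \<Rightarrow> 'k mdeg" where
  "meet m d = (\<lambda>i. the_enat (min (enat (m i)) (d i)))"

definition unit_deg :: "'k \<Rightarrow> 'k mdeg" where
  "unit_deg i = (\<lambda>j. if j = i then 1 else 0)"


text \<open>
  Objects and morphisms have separate carriers, linked by \<open>idm\<close>, which sends an object to its
  identity. \<open>rng\<close> is the codomain, \<open>src\<close> the domain, and \<open>cmp \<Lambda> f g\<close> is \<open>f \<circ> g\<close>, meaningful
  for \<open>src \<Lambda> f = rng \<Lambda> g\<close>.
\<close>

record ('v, 'a, 'k) kgraph =
  Obj :: "'v set"
  Mor :: "'a set"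
  rng :: "'a \<Rightarrow> 'v"
  src :: "'a \<Rightarrow> 'v"
  idm :: "'v \<Rightarrow> 'a"
  cmp :: "'a \<Rightarrow> 'a \<Rightarrow> 'a"
  deg :: "'a \<Rightarrow> 'k mdeg"

locale k_graph =
  fixes \<Lambda> :: "('v, 'a, 'k::finite) kgraph"
  assumes countable_Obj: "countable (Obj \<Lambda>)"
    and countable_Mor: "countable (Mor \<Lambda>)"
    and rng_in: "f \<in> Mor \<Lambda> \<Longrightarrow> rng \<Lambda> f \<in> Obj \<Lambda>"
    and src_in: "f \<in> Mor \<Lambda> \<Longrightarrow> src \<Lambda> f \<in> Obj \<Lambda>"
    and idm_in: "v \<in> Obj \<Lambda> \<Longrightarrow> idm \<Lambda> v \<in> Mor \<Lambda>"
    and rng_idm: "v \<in> Obj \<Lambda> \<Longrightarrow> rng \<Lambda> (idm \<Lambda> v) = v"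
    and src_idm: "v \<in> Obj \<Lambda> \<Longrightarrow> src \<Lambda> (idm \<Lambda> v) = v"
    and cmp_in: "\<lbrakk>f \<in> Mor \<Lambda>; g \<in> Mor \<Lambda>; src \<Lambda> f = rng \<Lambda> g\<rbrakk> \<Longrightarrow> cmp \<Lambda> f g \<in> Mor \<Lambda>"
    and rng_cmp: "\<lbrakk>f \<in> Mor \<Lambda>; g \<in> Mor \<Lambda>; src \<Lambda> f = rng \<Lambda> g\<rbrakk> \<Longrightarrow> rng \<Lambda> (cmp \<Lambda> f g) = rng \<Lambda> f"
    and src_cmp: "\<lbrakk>f \<in> Mor \<Lambda>; g \<in> Mor \<Lambda>; src \<Lambda> f = rng \<Lambda> g\<rbrakk> \<Longrightarrow> src \<Lambda> (cmp \<Lambda> f g) = src \<Lambda> g"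
    and cmp_assoc: "\<lbrakk>f \<in> Mor \<Lambda>; g \<in> Mor \<Lambda>; h \<in> Mor \<Lambda>; src \<Lambda> f = rng \<Lambda> g; src \<Lambda> g = rng \<Lambda> h\<rbrakk>
          \<Longrightarrow> cmp \<Lambda> (cmp \<Lambda> f g) h = cmp \<Lambda> f (cmp \<Lambda> g h)"
    and idm_cmp: "f \<in> Mor \<Lambda> \<Longrightarrow> cmp \<Lambda> (idm \<Lambda> (rng \<Lambda> f)) f = f"
    and cmp_idm: "f \<in> Mor \<Lambda> \<Longrightarrow> cmp \<Lambda> f (idm \<Lambda> (src \<Lambda> f)) = f"
    and deg_idm: "v \<in> Obj \<Lambda> \<Longrightarrow> deg \<Lambda> (idm \<Lambda> v) = 0"
    and deg_cmp: "\<lbrakk>f \<in> Mor \<Lambda>; g \<in> Mor \<Lambda>; src \<Lambda> f = rng \<Lambda> g\<rbrakk>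
          \<Longrightarrow> deg \<Lambda> (cmp \<Lambda> f g) = deg \<Lambda> f + deg \<Lambda> g"
    and factorisation: "\<lbrakk>f \<in> Mor \<Lambda>; deg \<Lambda> f = m + n\<rbrakk>
          \<Longrightarrow> \<exists>!(gh :: 'a \<times> 'a). case gh of (g, h) \<Rightarrow> g \<in> Mor \<Lambda> \<and> h \<in> Mor \<Lambda> \<and> deg \<Lambda> g = m \<and> deg \<Lambda> h = n
                \<and> src \<Lambda> g = rng \<Lambda> h \<and> f = cmp \<Lambda> g h"

text \<open>The set \<open>v\<Lambda>\<^sup>n\<close>.\<close>

definition paths_from :: "('v, 'a, 'k) kgraph \<Rightarrow> 'v \<Rightarrow> 'k mdeg \<Rightarrow> 'a set" where
  "paths_from \<Lambda> v n = {f \<in> Mor \<Lambda>. rng \<Lambda> f = v \<and> deg \<Lambda> f = n}"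

definition row_finite :: "('v, 'a, 'k) kgraph \<Rightarrow> bool" where
  "row_finite \<Lambda> \<longleftrightarrow> (\<forall>v \<in> Obj \<Lambda>. \<forall>n. finite (paths_from \<Lambda> v n))"

definition locally_convex :: "('v, 'a, 'k) kgraph \<Rightarrow> bool" where
  "locally_convex \<Lambda> \<longleftrightarrow>
     (\<forall>i j. \<forall>f \<in> Mor \<Lambda>. \<forall>g \<in> Mor \<Lambda>.
        i \<noteq> j \<and> deg \<Lambda> f = unit_deg i \<and> deg \<Lambda> g = unit_deg j \<and> rng \<Lambda> f = rng \<Lambda> g \<longrightarrow>
        paths_from \<Lambda> (src \<Lambda> f) (unit_deg j) \<noteq> {} \<and> paths_from \<Lambda> (src \<Lambda> g) (unit_deg i) \<noteq> {})"


definition Omega :: "'k xdeg \<Rightarrow> ('k mdeg, 'k mdeg \<times> 'k mdeg, 'k) kgraph" where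
  "Omega m = \<lparr>
     Obj = {p. emb p \<le> m},
     Mor = {(p, q). p \<le> q \<and> emb q \<le> m},
     rng = fst,
     src = snd,
     idm = (\<lambda>p. (p, p)),
     cmp = (\<lambda>f g. (fst f, snd g)),
     deg = (\<lambda>f. snd f - fst f) \<rparr>"

definition degree_preserving_functor ::
  "('v, 'a, 'k) kgraph \<Rightarrow> ('w, 'b, 'k) kgraph \<Rightarrow> ('v \<Rightarrow> 'w) \<Rightarrow> ('a \<Rightarrow> 'b) \<Rightarrow> bool" where
  "degree_preserving_functor \<Gamma> \<Lambda> F0 F1 \<longleftrightarrow>
     (\<forall>v \<in> Obj \<Gamma>. F0 v \<in> Obj \<Lambda> \<and> F1 (idm \<Gamma> v) = idm \<Lambda> (F0 v)) \<and>
     (\<forall>f \<in> Mor \<Gamma>. F1 f \<in> Mor \<Lambda> \<and> rng \<Lambda> (F1 f) = F0 (rng \<Gamma> f) \<and> src \<Lambda> (F1 f) = F0 (src \<Gamma> f)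
        \<and> deg \<Lambda> (F1 f) = deg \<Gamma> f) \<and>
     (\<forall>f \<in> Mor \<Gamma>. \<forall>g \<in> Mor \<Gamma>. src \<Gamma> f = rng \<Gamma> g \<longrightarrow> F1 (cmp \<Gamma> f g) = cmp \<Lambda> (F1 f) (F1 g))"

text \<open>
  A path is given by its degree together with the object map and the morphism map of a functor
  on \<^term>\<open>Omega (pdeg x)\<close>. Both maps are required to be \<^const>\<open>undefined\<close> outside this graph, so that
  equality of boundary paths is equality of functors.
\<close>

record ('v, 'a, 'k) kpath =
  pdeg :: "'k xdeg"
  pobj :: "'k mdeg \<Rightarrow> 'v"
  pmor :: "'k mdeg \<times> 'k mdeg \<Rightarrow> 'a"

definition boundary_paths :: "('v, 'a, 'k) kgraph \<Rightarrow> ('v, 'a, 'k) kpath set" where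
  "boundary_paths \<Lambda> = {x.
     degree_preserving_functor (Omega (pdeg x)) \<Lambda> (pobj x) (pmor x) \<and>
     pobj x \<in> extensional (Obj (Omega (pdeg x))) \<and>
     pmor x \<in> extensional (Mor (Omega (pdeg x))) \<and>
     (\<forall>p i. emb p \<le> pdeg x \<and> enat (p i) = pdeg x i \<longrightarrow>
        paths_from \<Lambda> (pobj x p) (unit_deg i) = {})}"

text \<open>The shift \<open>\<sigma>\<^sup>n(x)\<close>, for \<open>n \<le> d(x)\<close>.\<close>

definition shift :: "'k mdeg \<Rightarrow> ('v, 'a, 'k) kpath \<Rightarrow> ('v, 'a, 'k) kpath" where
  "shift n x = \<lparr>
     pdeg = pdeg x - emb n,
     pobj = restrict (\<lambda>p. pobj x (p + n)) (Obj (Omega (pdeg x - emb n))),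
     pmor = restrict (\<lambda>(p, q). pmor x (p + n, q + n)) (Mor (Omega (pdeg x - emb n))) \<rparr>"

text \<open>The concatenation \<open>\<lambda>x\<close>, for a path \<open>\<lambda>\<close> and a boundary path \<open>x\<close> with \<open>s(\<lambda>) = r(x)\<close>.\<close>

definition concat_path ::
  "('v, 'a, 'k) kgraph \<Rightarrow> 'a \<Rightarrow> ('v, 'a, 'k) kpath \<Rightarrow> ('v, 'a, 'k) kpath" where
  "concat_path \<Lambda> f x = (THE z. z \<in> boundary_paths \<Lambda> \<and> pdeg z = emb (deg \<Lambda> f) + pdeg x \<and>
     pmor z (0, deg \<Lambda> f) = f \<and> shift (deg \<Lambda> f) z = x)"


definition V_pre :: "('v, 'a, 'k) kgraph \<Rightarrow> (('v, 'a, 'k) kpath \<times> 'k mdeg) set" where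
  "V_pre \<Lambda> = {(x, m). x \<in> boundary_paths \<Lambda>}"

definition P_pre :: "('v, 'a, 'k) kgraph \<Rightarrow> (('v, 'a, 'k) kpath \<times> ('k mdeg \<times> 'k mdeg)) set" where
  "P_pre \<Lambda> = {(x, (m, n)). x \<in> boundary_paths \<Lambda> \<and> m \<le> n}"

definition V_rel :: "('v, 'a, 'k) kgraph \<Rightarrow> (('v, 'a, 'k) kpath \<times> 'k mdeg) rel" where
  "V_rel \<Lambda> = {((x, m), (y, n)). (x, m) \<in> V_pre \<Lambda> \<and> (y, n) \<in> V_pre \<Lambda> \<and>
     pobj x (meet m (pdeg x)) = pobj y (meet n (pdeg y)) \<and>
     m - meet m (pdeg x) = n - meet n (pdeg y)}"

definition P_rel :: "('v, 'a, 'k) kgraph \<Rightarrow> (('v, 'a, 'k) kpath \<times> ('k mdeg \<times> 'k mdeg)) rel" where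
  "P_rel \<Lambda> = {((x, (m, n)), (y, (p, q))). (x, (m, n)) \<in> P_pre \<Lambda> \<and> (y, (p, q)) \<in> P_pre \<Lambda> \<and>
     pmor x (meet m (pdeg x), meet n (pdeg x)) = pmor y (meet p (pdeg y), meet q (pdeg y)) \<and>
     m - meet m (pdeg x) = p - meet p (pdeg y) \<and>
     n - m = q - p}"

definition V_class :: "('v, 'a, 'k) kgraph \<Rightarrow> ('v, 'a, 'k) kpath \<Rightarrow> 'k mdeg
    \<Rightarrow> (('v, 'a, 'k) kpath \<times> 'k mdeg) set" where
  "V_class \<Lambda> x m = V_rel \<Lambda> `` {(x, m)}"

definition P_class :: "('v, 'a, 'k) kgraph \<Rightarrow> ('v, 'a, 'k) kpath \<Rightarrow> 'k mdeg \<times> 'k mdeg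
    \<Rightarrow> (('v, 'a, 'k) kpath \<times> ('k mdeg \<times> 'k mdeg)) set" where
  "P_class \<Lambda> x mn = P_rel \<Lambda> `` {(x, mn)}"

text \<open>
  \<open>tilde\<close> is Farthing's construction. As in \<^theory>\<open>HOL.Equiv_Relations\<close>, an operation with values in classes is defined on a class as the
  union of its values at all representatives. These values coincide (for the composition:
  when the two classes are composable), so that the union is their common value.
\<close>

definition tilde :: "('v, 'a, 'k) kgraph \<Rightarrow>
    ((('v, 'a, 'k) kpath \<times> 'k mdeg) set,
     (('v, 'a, 'k) kpath \<times> ('k mdeg \<times> 'k mdeg)) set, 'k) kgraph" where
  "tilde \<Lambda> = \<lparr>
     Obj = V_pre \<Lambda> // V_rel \<Lambda>,
     Mor = P_pre \<Lambda> // P_rel \<Lambda>,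
     rng = (\<lambda>A. \<Union>(x, (m, n)) \<in> A. V_class \<Lambda> x m),
     src = (\<lambda>A. \<Union>(x, (m, n)) \<in> A. V_class \<Lambda> x n),
     idm = (\<lambda>v. \<Union>(x, m) \<in> v. P_class \<Lambda> x (m, m)),
     cmp = (\<lambda>A B. \<Union>(x, (m, n)) \<in> A. \<Union>(y, (p, q)) \<in> B.
        P_class \<Lambda>
          (concat_path \<Lambda> (pmor x (0, meet n (pdeg x))) (shift (meet p (pdeg y)) y))
          (m, n + q - p)),
     deg = (\<lambda>A. the_elem ((\<lambda>(x, (m, n)). n - m) ` A)) \<rparr>"


definition cofinal_kgraph :: "('v, 'a, 'k) kgraph \<Rightarrow> bool" where
  "cofinal_kgraph \<Gamma> \<longleftrightarrow>
     (\<forall>x \<in> boundary_paths \<Gamma>. \<forall>v \<in> Obj \<Gamma>. \<exists>n. emb n \<le> pdeg x \<and>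
        {f \<in> Mor \<Gamma>. rng \<Gamma> f = v \<and> src \<Gamma> f = pobj x n} \<noteq> {})"

end

theory Submission
  imports Defs
begin

text \<open>
  Say that a vertex \<open>v\<close> has an edge in direction \<open>i\<close> if \<open>v\<Lambda>\<close> contains an edge of degree \<open>e\<^sub>i\<close>.
  Farthing's graph lets a boundary path \<open>x\<close> continue past its degree by imaginary steps, in the
  directions in which it has stopped. A class \<open>[x;m]\<close> is determined by the vertex
  \<open>v = x(m \<and> d(x))\<close> and the excess \<open>t = m - m \<and> d(x)\<close>, and the pairs \<open>(v,t)\<close> that occur are
  exactly those in which \<open>v\<close> has no edge in any direction \<open>i\<close> with \<open>t\<^sub>i > 0\<close>. A class
  \<open>[x;(m,n)]\<close> is determined by its real part \<open>f = x(m \<and> d(x), n \<and> d(x))\<close>, the excess \<open>t\<close> at its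
  range and its degree \<open>D = n - m\<close>; the excess at its source is then \<open>t + (D - d(f))\<close>. Again the
  triples that occur are exactly those in which \<open>r(f)\<close> has no edge in the directions where \<open>t\<close> is
  positive, and \<open>s(f)\<close> none in those where \<open>D - d(f)\<close> is positive (and \<open>d(f) \<le> D\<close>).
  In these coordinates composition composes the real parts and adds the degrees
  (lemmas \<open>rng_tilde\<close>, \<open>src_tilde\<close>, \<open>cmp_tilde\<close>), so that questions about \<open>tilde \<Lambda>\<close> become
  questions about paths of \<open>\<Lambda>\<close>.

  If \<open>tilde \<Lambda>\<close> is cofinal and \<open>x\<close> is a boundary path of \<open>\<Lambda>\<close>, then \<open>m \<mapsto> [x;m]\<close> is an infinite path of
  \<open>tilde \<Lambda>\<close>. Some path of \<open>tilde \<Lambda>\<close> has range \<open>(v,0)\<close> and source \<open>[x;n]\<close>, and its real part is a path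
  of \<open>\<Lambda>\<close> with range \<open>v\<close> and source \<open>x(n \<and> d(x))\<close>.

  Conversely let \<open>\<Lambda>\<close> be cofinal, \<open>X\<close> a boundary path and \<open>(w,s)\<close> a vertex of \<open>tilde \<Lambda>\<close>. Since
  every vertex of \<open>tilde \<Lambda>\<close> has edges in all directions, \<open>X\<close> is infinite. The real parts of
  \<open>X(0,(j,\<dots>,j))\<close> extend each other, and their limit is a boundary path of \<open>\<Lambda>\<close>: once the limit
  stops in a direction, \<open>X\<close> makes imaginary steps in that direction, which happens only at
  vertices without a real edge there. Cofinality of \<open>\<Lambda>\<close> joins \<open>w\<close> to a vertex of the limit, hence
  to the real vertex \<open>v\<close> of some \<open>X(J) = (v,t)\<close>. To lift this to \<open>tilde \<Lambda>\<close>, the excess at the source has to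
  dominate \<open>s\<close>. If \<open>s\<^sub>i > 0\<close> then \<open>w\<close> has no edge in direction \<open>i\<close>, and by the factorisation property
  no vertex reachable from \<open>w\<close> has one; so from \<open>J\<close> onwards every step of \<open>X\<close> in direction \<open>i\<close> is
  imaginary, and the excess at \<open>X(J + s)\<close> is large enough.

  All boundary paths that are needed (from a given vertex, concatenations, the limit above)
  come from the gluing lemma \<open>boundary_path_of_sequence\<close>. Local convexity enters through
  \<open>edge_transport\<close>: an edge in direction \<open>i\<close> is still available after moving in other directions.
\<close>

section \<open>Degrees\<close>

lemma emb_le_iff: "emb p \<le> d \<longleftrightarrow> (\<forall>i. enat (p i) \<le> d i)"
  by (simp add: emb_def le_fun_def)

lemma emb_le_trans: "p \<le> q \<Longrightarrow> emb q \<le> d \<Longrightarrow> emb p \<le> d"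
  unfolding emb_le_iff le_fun_def [of p q] by (meson enat_ord_simps(1) order_trans)

lemma emb_zero_le [simp]: "emb 0 \<le> d"
  by (simp add: emb_le_iff zero_enat_def [symmetric])

lemma enat_meet: "enat (meet m d i) = min (enat (m i)) (d i)"
  by (cases "d i") (auto simp: meet_def)

lemma emb_meet_le [simp]: "emb (meet m d) \<le> d"
  by (simp add: emb_le_iff enat_meet)

lemma meet_le: "meet m d \<le> m"
  unfolding le_fun_def by (metis enat_meet enat_ord_simps(1) min.cobounded1)

lemma meet_mono: "m \<le> n \<Longrightarrow> meet m d \<le> meet n d"
proof (unfold le_fun_def [of "meet m d"], rule allI)
  fix i assume "m \<le> n"
  then have "min (enat (m i)) (d i) \<le> min (enat (n i)) (d i)"
    by (intro min.mono) (auto simp: le_fun_def)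
  then show "meet m d i \<le> meet n d i" by (simp flip: enat_meet)
qed

lemma meet_absorb: "emb m \<le> d \<Longrightarrow> meet m d = m"
  by (rule ext) (metis emb_le_iff enat_meet enat.inject min.absorb1)

lemma zero_le_mdeg [simp]: "0 \<le> (m :: 'k mdeg)"
  by (simp add: le_fun_def)

lemma meet_zero [simp]: "meet 0 d = 0"
  by (rule meet_absorb) simp

lemma meet_full: "meet m d i < m i \<Longrightarrow> enat (meet m d i) = d i"
  by (metis enat_meet enat_ord_simps(2) min_def less_irrefl)

lemma mdeg_le_imp_ex_add:
  fixes m n :: "'k mdeg"
  assumes "m \<le> n" shows "n = m + (n - m)"
  using assms by (auto simp: le_fun_def fun_eq_iff)

lemma functor_Omega_iff:
  "degree_preserving_functor (Omega d) \<Gamma> F0 F1 \<longleftrightarrow>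
     (\<forall>p. emb p \<le> d \<longrightarrow> F0 p \<in> Obj \<Gamma> \<and> F1 (p, p) = idm \<Gamma> (F0 p)) \<and>
     (\<forall>p q. p \<le> q \<and> emb q \<le> d \<longrightarrow> F1 (p, q) \<in> Mor \<Gamma> \<and> rng \<Gamma> (F1 (p, q)) = F0 p \<and>
        src \<Gamma> (F1 (p, q)) = F0 q \<and> deg \<Gamma> (F1 (p, q)) = q - p) \<and>
     (\<forall>p q r. p \<le> q \<and> q \<le> r \<and> emb r \<le> d \<longrightarrow> F1 (p, r) = cmp \<Gamma> (F1 (p, q)) (F1 (q, r)))"
proof -
  have "(\<forall>f\<in>Mor (Omega d). \<forall>g\<in>Mor (Omega d). src (Omega d) f = rng (Omega d) g \<longrightarrow>
        F1 (cmp (Omega d) f g) = cmp \<Gamma> (F1 f) (F1 g)) \<longleftrightarrow>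
     (\<forall>p q r. p \<le> q \<and> q \<le> r \<and> emb r \<le> d \<longrightarrow> F1 (p, r) = cmp \<Gamma> (F1 (p, q)) (F1 (q, r)))"
    (is "?L \<longleftrightarrow> ?R")
  proof
    assume L: ?L
    show ?R
    proof (intro allI impI)
      fix p q r assume *: "p \<le> q \<and> q \<le> r \<and> emb r \<le> d"
      then have "emb q \<le> d" by (blast intro: emb_le_trans)
      with * show "F1 (p, r) = cmp \<Gamma> (F1 (p, q)) (F1 (q, r))"
        using L [rule_format, of "(p, q)" "(q, r)"] by (simp add: Omega_def)
    qed
  qed (auto simp: Omega_def)
  then show ?thesis
    unfolding degree_preserving_functor_def
    by (auto simp: Omega_def)
qed

text \<open>
  The extensionality conditions are stated as equations with \<open>undefined\<close>, which is the form in which a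
  path given by a conditional expression satisfies them.
\<close>

lemma boundary_pathsI:
  assumes "degree_preserving_functor (Omega (pdeg x)) \<Gamma> (pobj x) (pmor x)"
    and "\<And>p. \<not> emb p \<le> pdeg x \<Longrightarrow> pobj x p = undefined"
    and "\<And>p q. \<not> (p \<le> q \<and> emb q \<le> pdeg x) \<Longrightarrow> pmor x (p, q) = undefined"
    and "\<And>p i. emb p \<le> pdeg x \<Longrightarrow> enat (p i) = pdeg x i \<Longrightarrow>
      paths_from \<Gamma> (pobj x p) (unit_deg i) = {}"
  shows "x \<in> boundary_paths \<Gamma>"
  using assms by (auto simp: boundary_paths_def extensional_def Omega_def)

context
  fixes x :: "('v, 'a, 'k) kpath" and \<Gamma> :: "('v, 'a, 'k) kgraph"
  assumes x: "x \<in> boundary_paths \<Gamma>"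
begin

lemma pobj_in: "emb p \<le> pdeg x \<Longrightarrow> pobj x p \<in> Obj \<Gamma>"
  and pmor_idm: "emb p \<le> pdeg x \<Longrightarrow> pmor x (p, p) = idm \<Gamma> (pobj x p)"
  and pmor_in: "p \<le> q \<Longrightarrow> emb q \<le> pdeg x \<Longrightarrow> pmor x (p, q) \<in> Mor \<Gamma>"
  and rng_pmor: "p \<le> q \<Longrightarrow> emb q \<le> pdeg x \<Longrightarrow> rng \<Gamma> (pmor x (p, q)) = pobj x p"
  and src_pmor: "p \<le> q \<Longrightarrow> emb q \<le> pdeg x \<Longrightarrow> src \<Gamma> (pmor x (p, q)) = pobj x q"
  and deg_pmor: "p \<le> q \<Longrightarrow> emb q \<le> pdeg x \<Longrightarrow> deg \<Gamma> (pmor x (p, q)) = q - p"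
  and pmor_cmp: "p \<le> q \<Longrightarrow> q \<le> r \<Longrightarrow> emb r \<le> pdeg x \<Longrightarrow>
    cmp \<Gamma> (pmor x (p, q)) (pmor x (q, r)) = pmor x (p, r)"
  and boundary: "emb p \<le> pdeg x \<Longrightarrow> enat (p i) = pdeg x i \<Longrightarrow>
    paths_from \<Gamma> (pobj x p) (unit_deg i) = {}"
  and pobj_undefined: "\<not> emb p \<le> pdeg x \<Longrightarrow> pobj x p = undefined"
  and pmor_undefined: "\<not> (p \<le> q \<and> emb q \<le> pdeg x) \<Longrightarrow> pmor x (p, q) = undefined"
  using x unfolding boundary_paths_def functor_Omega_iff
  by (auto simp: extensional_def Omega_def)

end

section \<open>Factorisation\<close>

context k_graph
begin

text \<open>
  For \<open>f\<close> of degree at least \<open>m\<close>, the factorisation \<open>f = prefix f m \<cdot> suffix f m\<close> has its first factor of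
  degree \<open>m\<close>; \<open>segment f m n\<close> is then the path written \<open>f(m,n)\<close>.
\<close>

definition prefix :: "'a \<Rightarrow> 'k mdeg \<Rightarrow> 'a" where
  "prefix f m = (SOME g. \<exists>h. g \<in> Mor \<Lambda> \<and> h \<in> Mor \<Lambda> \<and> deg \<Lambda> g = m \<and> src \<Lambda> g = rng \<Lambda> h \<and> f = cmp \<Lambda> g h)"

definition suffix :: "'a \<Rightarrow> 'k mdeg \<Rightarrow> 'a" where
  "suffix f m = (SOME h. h \<in> Mor \<Lambda> \<and> src \<Lambda> (prefix f m) = rng \<Lambda> h \<and> f = cmp \<Lambda> (prefix f m) h)"

definition segment :: "'a \<Rightarrow> 'k mdeg \<Rightarrow> 'k mdeg \<Rightarrow> 'a" where
  "segment f m n = suffix (prefix f n) m"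

lemma prefix_suffix:
  assumes "f \<in> Mor \<Lambda>" "m \<le> deg \<Lambda> f"
  shows "prefix f m \<in> Mor \<Lambda>" "suffix f m \<in> Mor \<Lambda>" "deg \<Lambda> (prefix f m) = m"
    "src \<Lambda> (prefix f m) = rng \<Lambda> (suffix f m)" "cmp \<Lambda> (prefix f m) (suffix f m) = f"
    "deg \<Lambda> (suffix f m) = deg \<Lambda> f - m"
    "rng \<Lambda> (prefix f m) = rng \<Lambda> f" "src \<Lambda> (suffix f m) = src \<Lambda> f"
proof -
  have "\<exists>g h. g \<in> Mor \<Lambda> \<and> h \<in> Mor \<Lambda> \<and> deg \<Lambda> g = m \<and> src \<Lambda> g = rng \<Lambda> h \<and> f = cmp \<Lambda> g h"
    using factorisation [OF assms(1) mdeg_le_imp_ex_add [OF assms(2)]] by auto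
  from someI_ex [OF this]
  have 1: "prefix f m \<in> Mor \<Lambda>" "deg \<Lambda> (prefix f m) = m"
    and 2: "\<exists>h. h \<in> Mor \<Lambda> \<and> src \<Lambda> (prefix f m) = rng \<Lambda> h \<and> f = cmp \<Lambda> (prefix f m) h"
    unfolding prefix_def by blast+
  show "prefix f m \<in> Mor \<Lambda>" "deg \<Lambda> (prefix f m) = m" by fact+
  from someI_ex [OF 2]
  show 3: "suffix f m \<in> Mor \<Lambda>" "src \<Lambda> (prefix f m) = rng \<Lambda> (suffix f m)"
    "cmp \<Lambda> (prefix f m) (suffix f m) = f"
    unfolding suffix_def by metis+
  have "deg \<Lambda> f = m + deg \<Lambda> (suffix f m)"
    using deg_cmp [OF 1(1) 3(1,2)] 1(2) 3(3) by simp
  then show "deg \<Lambda> (suffix f m) = deg \<Lambda> f - m"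
    by (simp add: fun_eq_iff)
  show "rng \<Lambda> (prefix f m) = rng \<Lambda> f" "src \<Lambda> (suffix f m) = src \<Lambda> f"
    using rng_cmp [OF 1(1) 3(1,2)] src_cmp [OF 1(1) 3(1,2)] 3(3) by auto
qed

lemma cmp_cancel:
  assumes "g \<in> Mor \<Lambda>" "h \<in> Mor \<Lambda>" "src \<Lambda> g = rng \<Lambda> h"
    and "g' \<in> Mor \<Lambda>" "h' \<in> Mor \<Lambda>" "src \<Lambda> g' = rng \<Lambda> h'"
    and "cmp \<Lambda> g h = cmp \<Lambda> g' h'" "deg \<Lambda> g = deg \<Lambda> g'"
  shows "g = g'" "h = h'"
proof -
  have "deg \<Lambda> g + deg \<Lambda> h = deg \<Lambda> g' + deg \<Lambda> h'"
    using deg_cmp [OF assms(1-3)] deg_cmp [OF assms(4-6)] assms(7) by simp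
  then have "deg \<Lambda> h = deg \<Lambda> h'"
    using assms(8) by (simp add: fun_eq_iff)
  define Q where "Q = (\<lambda>gh. case gh of (a, b) \<Rightarrow> a \<in> Mor \<Lambda> \<and> b \<in> Mor \<Lambda> \<and> deg \<Lambda> a = deg \<Lambda> g \<and>
    deg \<Lambda> b = deg \<Lambda> h \<and> src \<Lambda> a = rng \<Lambda> b \<and> cmp \<Lambda> g h = cmp \<Lambda> a b)"
  have "\<exists>!gh. Q gh"
    unfolding Q_def by (rule factorisation [OF cmp_in [OF assms(1-3)] deg_cmp [OF assms(1-3)]])
  moreover have "Q (g, h)" "Q (g', h')"
    using assms \<open>deg \<Lambda> h = deg \<Lambda> h'\<close> by (simp_all add: Q_def)
  ultimately have "(g, h) = (g', h')" by blast
  then show "g = g'" "h = h'" by auto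
qed

lemma prefix_suffix_cmp:
  assumes "g \<in> Mor \<Lambda>" "h \<in> Mor \<Lambda>" "src \<Lambda> g = rng \<Lambda> h"
  shows "prefix (cmp \<Lambda> g h) (deg \<Lambda> g) = g" "suffix (cmp \<Lambda> g h) (deg \<Lambda> g) = h"
proof -
  have le: "deg \<Lambda> g \<le> deg \<Lambda> (cmp \<Lambda> g h)"
    using deg_cmp [OF assms] by (simp add: le_fun_def)
  note ps = prefix_suffix [OF cmp_in [OF assms] le]
  show "prefix (cmp \<Lambda> g h) (deg \<Lambda> g) = g" "suffix (cmp \<Lambda> g h) (deg \<Lambda> g) = h"
    using cmp_cancel [OF ps(1,2,4) assms ps(5,3)] by auto
qed

lemma prefix_of_cmp:
  assumes "g \<in> Mor \<Lambda>" "h \<in> Mor \<Lambda>" "src \<Lambda> g = rng \<Lambda> h" "m \<le> deg \<Lambda> g"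
  shows "prefix (cmp \<Lambda> g h) m = prefix g m"
proof -
  note ps = prefix_suffix [OF assms(1,4)]
  have "src \<Lambda> (suffix g m) = rng \<Lambda> h" using ps assms by simp
  note c = cmp_assoc [OF ps(1,2) assms(2) ps(4) this] cmp_in [OF ps(2) assms(2) this]
    rng_cmp [OF ps(2) assms(2) this]
  have "cmp \<Lambda> g h = cmp \<Lambda> (prefix g m) (cmp \<Lambda> (suffix g m) h)"
    using c(1) ps(5) by simp
  then show ?thesis
    using prefix_suffix_cmp(1) [OF ps(1) c(2)] c(3) ps(3,4) by simp
qed

text \<open>
  Segments do not see how a path is continued. For this reason they can be used to define a path as the
  limit of a sequence of extensions.
\<close>

lemma segment_of_cmp:
  assumes "g \<in> Mor \<Lambda>" "h \<in> Mor \<Lambda>" "src \<Lambda> g = rng \<Lambda> h" "n \<le> deg \<Lambda> g"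
  shows "segment (cmp \<Lambda> g h) m n = segment g m n"
  using prefix_of_cmp [OF assms] by (simp add: segment_def)

lemma prefix_deg [simp]: "f \<in> Mor \<Lambda> \<Longrightarrow> prefix f (deg \<Lambda> f) = f"
  using prefix_suffix_cmp(1) [of f "idm \<Lambda> (src \<Lambda> f)"] src_in [of f]
  by (simp add: idm_in rng_idm cmp_idm)

lemma suffix_zero [simp]: "f \<in> Mor \<Lambda> \<Longrightarrow> suffix f 0 = f"
  using prefix_suffix_cmp(2) [of "idm \<Lambda> (rng \<Lambda> f)" f] rng_in [of f]
  by (simp add: idm_in src_idm idm_cmp deg_idm)

lemma suffix_deg: "f \<in> Mor \<Lambda> \<Longrightarrow> suffix f (deg \<Lambda> f) = idm \<Lambda> (src \<Lambda> f)"
  using prefix_suffix_cmp(2) [of f "idm \<Lambda> (src \<Lambda> f)"] src_in [of f]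
  by (simp add: idm_in rng_idm cmp_idm)

text \<open>
  Both trivial factorisations of \<open>f\<close> with an identity have first factor of degree \<open>0\<close>, so they agree.
\<close>

lemma deg_zero:
  assumes "f \<in> Mor \<Lambda>" "deg \<Lambda> f = 0" shows "f = idm \<Lambda> (src \<Lambda> f)"
  using suffix_zero [OF assms(1)] suffix_deg [OF assms(1)] assms(2) by simp

lemma segment_props:
  assumes f: "f \<in> Mor \<Lambda>" and mn: "m \<le> n" and n: "n \<le> deg \<Lambda> f"
  shows "segment f m n \<in> Mor \<Lambda>" "deg \<Lambda> (segment f m n) = n - m"
    "src \<Lambda> (segment f m n) = src \<Lambda> (prefix f n)"
    "rng \<Lambda> (segment f m n) = src \<Lambda> (prefix f m)"
proof -
  note ps = prefix_suffix [OF f n]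
  have m: "m \<le> deg \<Lambda> (prefix f n)" using ps mn by simp
  note ps' = prefix_suffix [OF ps(1) m]
  show "segment f m n \<in> Mor \<Lambda>" "deg \<Lambda> (segment f m n) = n - m"
    "src \<Lambda> (segment f m n) = src \<Lambda> (prefix f n)"
    unfolding segment_def using ps' ps by auto
  have "prefix (prefix f n) m = prefix f m"
    using prefix_of_cmp [OF ps(1,2,4) m] ps(5) by simp
  then show "rng \<Lambda> (segment f m n) = src \<Lambda> (prefix f m)"
    unfolding segment_def using ps'(4) by simp
qed

text \<open>
  Factor \<open>g = f(0,p)\<close> as \<open>f(0,m) \<cdot> f(m,n) \<cdot> f(n,p)\<close>; the part after degree \<open>m\<close> is the product of the last
  two factors by uniqueness.
\<close>

lemma segment_trans:
  assumes f: "f \<in> Mor \<Lambda>" and mn: "m \<le> n" and np: "n \<le> p" and p: "p \<le> deg \<Lambda> f"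
  shows "cmp \<Lambda> (segment f m n) (segment f n p) = segment f m p"
proof -
  define g where "g = prefix f p"
  have g: "g \<in> Mor \<Lambda>" "deg \<Lambda> g = p"
    using prefix_suffix [OF f p] by (auto simp: g_def)
  have n: "n \<le> deg \<Lambda> g" using g np by simp
  note s = prefix_suffix [OF g(1) n]
  have m: "m \<le> deg \<Lambda> (prefix g n)" using s mn by simp
  note t = prefix_suffix [OF s(1) m]
  have "prefix f n = prefix g n"
    using prefix_of_cmp [of g "suffix f p" n] prefix_suffix [OF f p] n
    unfolding g_def by metis
  then have seg: "segment f m n = suffix (prefix g n) m" "segment f n p = suffix g n"
    "segment f m p = suffix g m"
    by (simp_all add: segment_def g_def)
  have c: "src \<Lambda> (suffix (prefix g n) m) = rng \<Lambda> (suffix g n)"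
    using t s by simp
  have "g = cmp \<Lambda> (prefix (prefix g n) m) (cmp \<Lambda> (suffix (prefix g n) m) (suffix g n))"
    using cmp_assoc [OF t(1,2) s(2) t(4) c] t(5) s(5) by simp
  moreover have "rng \<Lambda> (cmp \<Lambda> (suffix (prefix g n) m) (suffix g n)) =
      src \<Lambda> (prefix (prefix g n) m)"
    using rng_cmp [OF t(2) s(2) c] t(4) by simp
  ultimately have "suffix g m = cmp \<Lambda> (suffix (prefix g n) m) (suffix g n)"
    using prefix_suffix_cmp(2) [OF t(1) cmp_in [OF t(2) s(2) c]] t(3) by metis
  then show ?thesis using seg by simp
qed

lemma segment_idm:
  assumes f: "f \<in> Mor \<Lambda>" and n: "n \<le> deg \<Lambda> f"
  shows "segment f n n = idm \<Lambda> (src \<Lambda> (prefix f n))"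
  unfolding segment_def using suffix_deg [of "prefix f n"] prefix_suffix [OF f n] by metis

lemma pmor_eq_segment:
  assumes x: "x \<in> boundary_paths \<Lambda>" and "p \<le> q" "q \<le> r" "emb r \<le> pdeg x"
  shows "pmor x (p, q) = segment (pmor x (0, r)) p q"
proof -
  have q: "emb q \<le> pdeg x" "0 \<le> q" and p: "emb p \<le> pdeg x" "0 \<le> p"
    using emb_le_trans [OF assms(3,4)] emb_le_trans [OF assms(2)] by auto
  have "prefix (pmor x (0, r)) q = pmor x (0, q)"
    using prefix_suffix_cmp(1) [of "pmor x (0, q)" "pmor x (q, r)"] assms q
    by (simp add: pmor_in rng_pmor src_pmor pmor_cmp deg_pmor)
  moreover have "suffix (pmor x (0, q)) p = pmor x (p, q)"
    using prefix_suffix_cmp(2) [of "pmor x (0, p)" "pmor x (p, q)"] assms q p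
    by (simp add: pmor_in rng_pmor src_pmor pmor_cmp deg_pmor)
  ultimately show ?thesis
    by (simp add: segment_def)
qed

text \<open>
  A path is determined by arbitrarily long initial pieces, as every other piece is a segment of one of them.
\<close>

lemma boundary_path_eqI:
  assumes x: "x \<in> boundary_paths \<Lambda>" and y: "y \<in> boundary_paths \<Lambda>" and d: "pdeg x = pdeg y"
    and eq: "\<And>q. emb q \<le> pdeg x \<Longrightarrow> \<exists>r\<ge>q. emb r \<le> pdeg x \<and> pmor x (0, r) = pmor y (0, r)"
  shows "x = y"
proof -
  have mor: "pmor x (p, q) = pmor y (p, q)" for p q
  proof (cases "p \<le> q \<and> emb q \<le> pdeg x")
    case True
    then obtain r where "q \<le> r" "emb r \<le> pdeg x" "pmor x (0, r) = pmor y (0, r)"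
      using eq by blast
    then show ?thesis
      using pmor_eq_segment [OF x, of p q r] pmor_eq_segment [OF y, of p q r] True d by simp
  next
    case False
    then show ?thesis using pmor_undefined [OF x] pmor_undefined [OF y] d by metis
  qed
  have obj: "pobj x p = pobj y p" for p
  proof (cases "emb p \<le> pdeg x")
    case True
    then show ?thesis
      using mor [of p p] rng_pmor [OF x, of p p] rng_pmor [OF y, of p p] d by simp
  next
    case False
    then show ?thesis using pobj_undefined [OF x] pobj_undefined [OF y] d by metis
  qed
  show ?thesis using mor obj d by (intro kpath.equality) auto
qed

lemma edge_of_deg_pos:
  assumes f: "f \<in> Mor \<Lambda>" and i: "0 < deg \<Lambda> f i"
  shows "paths_from \<Lambda> (rng \<Lambda> f) (unit_deg i) \<noteq> {}"
proof -
  have "unit_deg i \<le> deg \<Lambda> f" using i by (auto simp: le_fun_def unit_deg_def)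
  from prefix_suffix [OF f this] show ?thesis by (auto simp: paths_from_def)
qed

text \<open>
  Appending to \<open>f\<close> an edge at its source gives a path with positive degree in direction \<open>i\<close>, and the
  factorisation property moves that edge to the front.
\<close>

lemma edge_back:
  assumes f: "f \<in> Mor \<Lambda>" and e: "paths_from \<Lambda> (src \<Lambda> f) (unit_deg i) \<noteq> {}"
  shows "paths_from \<Lambda> (rng \<Lambda> f) (unit_deg i) \<noteq> {}"
proof -
  obtain g where g: "g \<in> Mor \<Lambda>" "src \<Lambda> f = rng \<Lambda> g" "deg \<Lambda> g = unit_deg i"
    using e by (auto simp: paths_from_def)
  have "0 < deg \<Lambda> (cmp \<Lambda> f g) i"
    using deg_cmp [OF f g(1,2)] g(3) by (simp add: unit_deg_def)
  from edge_of_deg_pos [OF cmp_in [OF f g(1,2)] this] show ?thesis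
    using rng_cmp [OF f g(1,2)] by simp
qed

end

section \<open>Local convexity\<close>

locale locally_convex_k_graph = k_graph \<Lambda>
  for \<Lambda> :: "('v, 'a, 'k::finite) kgraph" +
  assumes locally_convex: "locally_convex \<Lambda>"
begin

text \<open>
  Move along \<open>f\<close> one edge at a time. No edge of \<open>f\<close> has direction \<open>i\<close>, and so local convexity carries the
  edge in direction \<open>i\<close> across each of them.
\<close>

lemma edge_transport:
  assumes "f \<in> Mor \<Lambda>" "deg \<Lambda> f i = 0" "paths_from \<Lambda> (rng \<Lambda> f) (unit_deg i) \<noteq> {}"
  shows "paths_from \<Lambda> (src \<Lambda> f) (unit_deg i) \<noteq> {}"
  using assms
proof (induction "\<Sum>j\<in>UNIV. deg \<Lambda> f j" arbitrary: f rule: less_induct)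
  case less
  show ?case
  proof (cases "deg \<Lambda> f = 0")
    case True
    then show ?thesis
      using deg_zero [OF less.prems(1)] src_in [OF less.prems(1)] rng_idm less.prems(3) by metis
  next
    case False
    then obtain j where j: "deg \<Lambda> f j > 0" by (auto simp: fun_eq_iff)
    then have ij: "i \<noteq> j" using less.prems(2) by auto
    have le: "unit_deg j \<le> deg \<Lambda> f" using j by (auto simp: le_fun_def unit_deg_def)
    note ps = prefix_suffix [OF less.prems(1) le]
    obtain g where "g \<in> Mor \<Lambda>" "deg \<Lambda> g = unit_deg i" "rng \<Lambda> g = rng \<Lambda> f"
      using less.prems(3) by (auto simp: paths_from_def)
    then have "paths_from \<Lambda> (src \<Lambda> (prefix f (unit_deg j))) (unit_deg i) \<noteq> {}"
      using locally_convex ps ij unfolding locally_convex_def by metis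
    then have e: "paths_from \<Lambda> (rng \<Lambda> (suffix f (unit_deg j))) (unit_deg i) \<noteq> {}"
      using ps(4) by simp
    have "(\<Sum>l\<in>UNIV. deg \<Lambda> (suffix f (unit_deg j)) l) < (\<Sum>l\<in>UNIV. deg \<Lambda> f l)"
      by (rule sum_strict_mono_ex1) (use j ps(6) in \<open>auto simp: unit_deg_def intro!: exI [of _ j]\<close>)
    from less.hyps [OF this ps(2) _ e] show ?thesis
      using ps(6,8) less.prems(2) by simp
  qed
qed

text \<open>
  Adding the directions of \<open>I\<close> one by one, \<open>edge_transport\<close> keeps the remaining directions available. A path
  that is extended in this way at each step eventually moves in every direction in which it can.
\<close>

lemma obtain_path_with_edges:
  assumes v: "v \<in> Obj \<Lambda>" and I: "\<And>i. i \<in> I \<Longrightarrow> paths_from \<Lambda> v (unit_deg i) \<noteq> {}"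
  obtains f where "f \<in> Mor \<Lambda>" "rng \<Lambda> f = v" "\<And>i. i \<in> I \<Longrightarrow> deg \<Lambda> f i > 0"
proof -
  have "\<exists>f\<in>Mor \<Lambda>. rng \<Lambda> f = v \<and> (\<forall>i. deg \<Lambda> f i = (if i \<in> I then 1 else 0))"
    using finite [of I] I
  proof (induction rule: finite_induct)
    case empty
    show ?case
      using v by (intro bexI [of _ "idm \<Lambda> v"]) (auto simp: rng_idm deg_idm idm_in)
  next
    case (insert i I)
    then obtain f where f: "f \<in> Mor \<Lambda>" "rng \<Lambda> f = v"
      "\<And>i. deg \<Lambda> f i = (if i \<in> I then 1 else 0)" by auto
    have "paths_from \<Lambda> (src \<Lambda> f) (unit_deg i) \<noteq> {}"
      using edge_transport [of f i] f insert by auto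
    then obtain g where g: "g \<in> Mor \<Lambda>" "src \<Lambda> f = rng \<Lambda> g" "deg \<Lambda> g = unit_deg i"
      by (auto simp: paths_from_def)
    show ?case
      using cmp_in [OF f(1) g(1,2)] rng_cmp [OF f(1) g(1,2)] deg_cmp [OF f(1) g(1,2)] f g insert(2)
      by (intro bexI [of _ "cmp \<Lambda> f g"]) (auto simp: unit_deg_def)
  qed
  then show ?thesis using that by (metis zero_less_one)
qed

section \<open>Gluing\<close>

text \<open>
  The limit of paths that extend each other. Its pieces are segments of any sufficiently late path in the
  sequence. The growth condition makes it a boundary path: when the limit has degree \<open>p\<^sub>i\<close> in direction \<open>i\<close>
  at \<open>p\<close>, a path \<open>c j\<close> beyond \<open>p\<close> has stopped growing in direction \<open>i\<close>, so its source has no edge in this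
  direction, and by \<open>edge_transport\<close> there is none at \<open>p\<close>.
\<close>

lemma boundary_path_of_sequence:
  assumes c: "\<And>j. c j \<in> Mor \<Lambda>"
    and step: "\<And>j. \<exists>h\<in>Mor \<Lambda>. src \<Lambda> (c j) = rng \<Lambda> h \<and> c (Suc j) = cmp \<Lambda> (c j) h"
    and grow: "\<And>j i. paths_from \<Lambda> (src \<Lambda> (c j)) (unit_deg i) \<noteq> {} \<Longrightarrow>
      \<exists>j'. deg \<Lambda> (c j) i < deg \<Lambda> (c j') i"
  obtains z where "z \<in> boundary_paths \<Lambda>" "pdeg z = (\<lambda>i. SUP j. enat (deg \<Lambda> (c j) i))"
    "\<And>j. pmor z (0, deg \<Lambda> (c j)) = c j" "\<And>q. emb q \<le> pdeg z \<Longrightarrow> \<exists>j. q \<le> deg \<Lambda> (c j)"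
proof -
  have ext: "\<exists>h\<in>Mor \<Lambda>. src \<Lambda> (c j) = rng \<Lambda> h \<and> c j' = cmp \<Lambda> (c j) h" if "j \<le> j'" for j j'
    using that
  proof (induction rule: dec_induct)
    case base
    show ?case
      using c [of j] src_in [OF c [of j]]
      by (intro bexI [of _ "idm \<Lambda> (src \<Lambda> (c j))"]) (auto simp: cmp_idm rng_idm idm_in)
  next
    case (step n)
    then obtain h where h: "h \<in> Mor \<Lambda>" "src \<Lambda> (c j) = rng \<Lambda> h" "c n = cmp \<Lambda> (c j) h" by blast
    obtain g where g: "g \<in> Mor \<Lambda>" "src \<Lambda> (c n) = rng \<Lambda> g" "c (Suc n) = cmp \<Lambda> (c n) g"
      using assms(2) by blast
    have s: "src \<Lambda> h = rng \<Lambda> g" using g h src_cmp [OF c h(1,2)] by simp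
    show ?case
      using cmp_assoc [OF c h(1) g(1) h(2) s] cmp_in [OF h(1) g(1) s] rng_cmp [OF h(1) g(1) s] g h
      by (intro bexI [of _ "cmp \<Lambda> h g"]) auto
  qed
  have mono: "deg \<Lambda> (c j) \<le> deg \<Lambda> (c j')" if "j \<le> j'" for j j'
  proof -
    obtain h where "h \<in> Mor \<Lambda>" "src \<Lambda> (c j) = rng \<Lambda> h" "c j' = cmp \<Lambda> (c j) h"
      using ext [OF \<open>j \<le> j'\<close>] by blast
    then show ?thesis using deg_cmp [OF c, of h j] by (simp add: le_fun_def)
  qed
  have seg: "segment (c j') p q = segment (c j) p q"
    if "q \<le> deg \<Lambda> (c j)" "q \<le> deg \<Lambda> (c j')" for j j' p q
  proof -
    have *: "segment (c j') p q = segment (c j) p q" if "j \<le> j'" "q \<le> deg \<Lambda> (c j)" for j j'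
      using ext [OF that(1)] segment_of_cmp [OF c] that(2) by metis
    show ?thesis using * [of j j'] * [of j' j] that by (cases "j \<le> j'") auto
  qed
  define D where "D = (\<lambda>i. SUP j. enat (deg \<Lambda> (c j) i))"
  have le_D: "emb (deg \<Lambda> (c j)) \<le> D" for j
    unfolding emb_le_iff D_def by (auto intro: SUP_upper)
  have ex: "\<exists>j. q \<le> deg \<Lambda> (c j)" if "emb q \<le> D" for q
  proof -
    \<comment> \<open>One index per direction suffices for each coordinate; their maximum serves all, by monotonicity.\<close>
    have "\<exists>j. q i \<le> deg \<Lambda> (c j) i" for i
    proof (rule ccontr)
      assume "\<nexists>j. q i \<le> deg \<Lambda> (c j) i"
      then have *: "deg \<Lambda> (c j) i < q i" for j by (simp add: not_le)
      have "deg \<Lambda> (c j) i \<le> q i - 1" for j using * [of j] by simp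
      then have "D i \<le> enat (q i - 1)"
        unfolding D_def by (intro SUP_least) simp
      moreover have "enat (q i) \<le> D i" using that by (simp add: emb_le_iff)
      ultimately have "q i \<le> q i - 1" by (metis enat_ord_simps(1) order_trans)
      then show False using * [of 0] by simp
    qed
    then obtain J where J: "\<And>i. q i \<le> deg \<Lambda> (c (J i)) i" by metis
    have "q \<le> deg \<Lambda> (c (Max (range J)))"
      unfolding le_fun_def
    proof
      fix i
      have "J i \<le> Max (range J)" by simp
      from mono [OF this] show "q i \<le> deg \<Lambda> (c (Max (range J))) i"
        using J [of i] by (auto simp: le_fun_def intro: order_trans)
    qed
    then show ?thesis by blast
  qed
  define J where "J q = (SOME j. q \<le> deg \<Lambda> (c j))" for q
  have J: "q \<le> deg \<Lambda> (c (J q))" if "emb q \<le> D" for q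
    unfolding J_def using someI_ex [OF ex [OF that]] .
  define z :: "('v, 'a, 'k) kpath" where "z = \<lparr> pdeg = D,
     pobj = (\<lambda>p. if emb p \<le> D then src \<Lambda> (prefix (c (J p)) p) else undefined),
     pmor = (\<lambda>(p, q). if p \<le> q \<and> emb q \<le> D then segment (c (J q)) p q else undefined) \<rparr>"
  have obj: "pobj z p = src \<Lambda> (prefix (c j) p)" if "p \<le> deg \<Lambda> (c j)" for p j
  proof -
    have p: "emb p \<le> D" using emb_le_trans [OF that le_D] .
    have "segment (c (J p)) p p = segment (c j) p p" by (rule seg) (use that J p in auto)
    then have "src \<Lambda> (prefix (c (J p)) p) = src \<Lambda> (prefix (c j) p)"
      using segment_props(3) [OF c order_refl] that J [OF p] by metis
    then show ?thesis using p by (simp add: z_def)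
  qed
  have mor: "pmor z (p, q) = segment (c j) p q" if "p \<le> q" "q \<le> deg \<Lambda> (c j)" for p q j
    using that emb_le_trans [OF that(2) le_D] seg [of q j "J q" p] J [of q] by (auto simp: z_def)
  have pdeg: "pdeg z = D" by (simp add: z_def)
  have z: "z \<in> boundary_paths \<Lambda>"
  proof (rule boundary_pathsI)
    show "degree_preserving_functor (Omega (pdeg z)) \<Lambda> (pobj z) (pmor z)"
      unfolding functor_Omega_iff pdeg
    proof (intro conjI allI impI)
      fix p assume "emb p \<le> D"
      then obtain j where j: "p \<le> deg \<Lambda> (c j)" using ex by blast
      show "pobj z p \<in> Obj \<Lambda>" "pmor z (p, p) = idm \<Lambda> (pobj z p)"
        using obj [OF j] mor [OF order_refl j] segment_idm [OF c j] src_in prefix_suffix(1) [OF c j]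
        by auto
    next
      fix p q assume pq: "p \<le> q \<and> emb q \<le> D"
      then obtain j where j: "q \<le> deg \<Lambda> (c j)" using ex by blast
      then have j': "p \<le> deg \<Lambda> (c j)" using pq by auto
      note s = segment_props [OF c conjunct1 [OF pq] j]
      show "pmor z (p, q) \<in> Mor \<Lambda>" "rng \<Lambda> (pmor z (p, q)) = pobj z p"
        "src \<Lambda> (pmor z (p, q)) = pobj z q" "deg \<Lambda> (pmor z (p, q)) = q - p"
        using s obj [OF j] obj [OF j'] mor [OF conjunct1 [OF pq] j] by auto
    next
      fix p q r assume pq: "p \<le> q \<and> q \<le> r \<and> emb r \<le> D"
      then obtain j where j: "r \<le> deg \<Lambda> (c j)" using ex by blast
      then show "pmor z (p, r) = cmp \<Lambda> (pmor z (p, q)) (pmor z (q, r))"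
        using segment_trans [OF c _ _ j, of p q] mor [of p r j] mor [of p q j] mor [of q r j] pq
        by auto
    qed
  next
    fix p i assume p: "emb p \<le> pdeg z" and pi: "enat (p i) = pdeg z i"
    then obtain j where j: "p \<le> deg \<Lambda> (c j)" using ex pdeg by metis
    have bound: "deg \<Lambda> (c j') i \<le> p i" for j'
      using le_D [of j'] pi pdeg by (metis emb_le_iff enat_ord_simps(1))
    have eq: "deg \<Lambda> (c j) i = p i" using bound [of j] j by (simp add: le_fun_def antisym)
    note ps = prefix_suffix [OF c j]
    show "paths_from \<Lambda> (pobj z p) (unit_deg i) = {}"
    proof (rule ccontr)
      assume "paths_from \<Lambda> (pobj z p) (unit_deg i) \<noteq> {}"
      then have "paths_from \<Lambda> (src \<Lambda> (c j)) (unit_deg i) \<noteq> {}"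
        using edge_transport [OF ps(2), of i] ps eq obj [OF j] by simp
      then show False using grow [of j i] bound eq by (metis not_le)
    qed
  qed (auto simp: z_def)
  have "pmor z (0, deg \<Lambda> (c j)) = c j" for j
    using mor [of 0 "deg \<Lambda> (c j)" j] c [of j] by (simp add: segment_def le_fun_def)
  then show ?thesis using that [OF z] ex pdeg D_def by simp
qed

lemma ex_boundary_path:
  assumes v: "v \<in> Obj \<Lambda>"
  obtains z where "z \<in> boundary_paths \<Lambda>" "pobj z 0 = v"
proof -
  define R where "R f g \<longleftrightarrow> (\<exists>h\<in>Mor \<Lambda>. src \<Lambda> f = rng \<Lambda> h \<and> g = cmp \<Lambda> f h) \<and>
      (\<forall>i. paths_from \<Lambda> (src \<Lambda> f) (unit_deg i) \<noteq> {} \<longrightarrow> deg \<Lambda> f i < deg \<Lambda> g i)" for f g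
  have extend: "\<exists>g. g \<in> Mor \<Lambda> \<and> R f g" if f: "f \<in> Mor \<Lambda>" for f
  proof -
    define I where "I = {i. paths_from \<Lambda> (src \<Lambda> f) (unit_deg i) \<noteq> {}}"
    obtain h where h: "h \<in> Mor \<Lambda>" "rng \<Lambda> h = src \<Lambda> f" "\<And>i. i \<in> I \<Longrightarrow> deg \<Lambda> h i > 0"
      using obtain_path_with_edges [OF src_in [OF f], of I] by (auto simp: I_def)
    note s = h(2) [symmetric]
    have "R f (cmp \<Lambda> f h)"
      unfolding R_def using h deg_cmp [OF f h(1) s] by (auto simp: I_def intro!: bexI [of _ h])
    then show ?thesis using cmp_in [OF f h(1) s] by blast
  qed
  have "\<exists>c. \<forall>j. (c j \<in> Mor \<Lambda> \<and> (j = 0 \<longrightarrow> c j = idm \<Lambda> v)) \<and> R (c j) (c (Suc j))"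
    by (rule dependent_nat_choice) (use idm_in [OF v] extend in auto)
  then obtain c where c: "\<And>j. c j \<in> Mor \<Lambda>" and c0: "c 0 = idm \<Lambda> v"
    and R: "\<And>j. R (c j) (c (Suc j))" by auto
  obtain z where z: "z \<in> boundary_paths \<Lambda>" "\<And>j. pmor z (0, deg \<Lambda> (c j)) = c j"
  proof (rule boundary_path_of_sequence [of c])
    show "\<exists>h\<in>Mor \<Lambda>. src \<Lambda> (c j) = rng \<Lambda> h \<and> c (Suc j) = cmp \<Lambda> (c j) h" for j
      using R [of j] by (simp add: R_def)
    show "\<exists>j'. deg \<Lambda> (c j) i < deg \<Lambda> (c j') i"
      if "paths_from \<Lambda> (src \<Lambda> (c j)) (unit_deg i) \<noteq> {}" for j i
      using R [of j] that by (auto simp: R_def)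
  qed (use c in auto)
  have "pmor z (0, 0) = idm \<Lambda> v" using z(2) [of 0] c0 deg_idm [OF v] by simp
  then have "pobj z 0 = v" using rng_pmor [OF z(1), of 0 0] rng_idm [OF v] by simp
  then show ?thesis using that z by blast
qed

end

section \<open>Shifts and concatenations\<close>

lemma emb_le_minus_iff:
  assumes "emb n \<le> d"
  shows "emb p \<le> d - emb n \<longleftrightarrow> emb (p + n) \<le> d"
proof -
  have "enat (p i) \<le> d i - enat (n i) \<longleftrightarrow> enat (p i + n i) \<le> d i" for i
    using assms [unfolded emb_le_iff, rule_format, of i] by (cases "d i") auto
  then show ?thesis unfolding emb_le_iff by (simp add: emb_def)
qed

lemma emb_le_plus_iff: "emb (n + p) \<le> emb n + d \<longleftrightarrow> emb p \<le> d"
proof -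
  have "enat (n i + p i) \<le> enat (n i) + d i \<longleftrightarrow> enat (p i) \<le> d i" for i
    by (cases "d i") auto
  then show ?thesis unfolding emb_le_iff by (simp add: emb_def)
qed

lemma emb_plus_minus [simp]: "emb n + d - emb n = d"
proof
  fix i show "(emb n + d - emb n) i = d i" by (cases "d i") (auto simp: emb_def)
qed

lemma emb_le_imp_meet_const:
  fixes q :: "('k :: finite) mdeg"
  assumes "emb q \<le> d"
  obtains j where "q \<le> meet (\<lambda>_. j) d"
proof -
  have "q i \<le> meet (\<lambda>_. Max (range q)) d i" for i
  proof -
    have "q i \<le> Max (range q)" by simp
    then have "enat (q i) \<le> enat (meet (\<lambda>_. Max (range q)) d i)"
      using assms by (simp add: enat_meet emb_le_iff)
    then show ?thesis by simp
  qed
  then show ?thesis using that [unfolded le_fun_def] by blast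
qed

lemma mdeg_diff_zero [simp]: "m - 0 = (m :: 'k mdeg)"
  by (simp add: fun_eq_iff)

lemma shift_sel:
  "pdeg (shift n x) = pdeg x - emb n"
  "emb n \<le> pdeg x \<Longrightarrow> emb (p + n) \<le> pdeg x \<Longrightarrow> pobj (shift n x) p = pobj x (p + n)"
  "emb n \<le> pdeg x \<Longrightarrow> p \<le> q \<Longrightarrow> emb (q + n) \<le> pdeg x \<Longrightarrow>
    pmor (shift n x) (p, q) = pmor x (p + n, q + n)"
  by (auto simp: shift_def Omega_def emb_le_minus_iff)

lemma shift_boundary_path:
  fixes \<Gamma> :: "('v, 'a, 'k) kgraph"
  assumes x: "x \<in> boundary_paths \<Gamma>" and n: "emb n \<le> pdeg x"
  shows "shift n x \<in> boundary_paths \<Gamma>"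
proof (rule boundary_pathsI)
  have add: "p + n \<le> q + n" if "p \<le> q" for p q :: "'k mdeg"
    using that by (simp add: le_fun_def)
  have le: "emb (p + n) \<le> pdeg x" if "p \<le> q" "emb (q + n) \<le> pdeg x" for p q
    using emb_le_trans [OF add [OF that(1)] that(2)] .
  have diff: "q + n - (p + n) = q - p" for p q :: "'k mdeg"
    by (simp add: fun_eq_iff)
  show "degree_preserving_functor (Omega (pdeg (shift n x))) \<Gamma> (pobj (shift n x)) (pmor (shift n x))"
    unfolding functor_Omega_iff shift_sel(1) emb_le_minus_iff [OF n]
  proof (intro conjI allI impI)
    fix p assume "emb (p + n) \<le> pdeg x"
    then show "pobj (shift n x) p \<in> Obj \<Gamma>" "pmor (shift n x) (p, p) = idm \<Gamma> (pobj (shift n x) p)"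
      using shift_sel(2,3) [OF n] pobj_in [OF x] pmor_idm [OF x] by simp_all
  next
    fix p q assume *: "p \<le> q \<and> emb (q + n) \<le> pdeg x"
    then have "emb (p + n) \<le> pdeg x" using le by blast
    with * show "pmor (shift n x) (p, q) \<in> Mor \<Gamma>"
      "rng \<Gamma> (pmor (shift n x) (p, q)) = pobj (shift n x) p"
      "src \<Gamma> (pmor (shift n x) (p, q)) = pobj (shift n x) q"
      "deg \<Gamma> (pmor (shift n x) (p, q)) = q - p"
      using le shift_sel(2,3) [OF n] pmor_in [OF x] rng_pmor [OF x] src_pmor [OF x] deg_pmor [OF x]
        add diff by simp_all
  next
    fix p q r assume *: "p \<le> q \<and> q \<le> r \<and> emb (r + n) \<le> pdeg x"
    then have "p \<le> r" "emb (q + n) \<le> pdeg x" using le by auto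
    with * show "pmor (shift n x) (p, r) = cmp \<Gamma> (pmor (shift n x) (p, q)) (pmor (shift n x) (q, r))"
      using shift_sel(3) [OF n] pmor_cmp [OF x] add by simp
  qed
  show "paths_from \<Gamma> (pobj (shift n x) p) (unit_deg i) = {}"
    if p: "emb p \<le> pdeg (shift n x)" and i: "enat (p i) = pdeg (shift n x) i" for p i
  proof -
    have p': "emb (p + n) \<le> pdeg x" using p by (simp add: shift_sel emb_le_minus_iff [OF n])
    have "enat ((p + n) i) = pdeg x i"
      using i n [unfolded emb_le_iff, rule_format, of i]
      by (cases "pdeg x i") (auto simp: shift_sel emb_def)
    then show ?thesis using boundary [OF x p'] shift_sel(2) [OF n p'] by simp
  qed
qed (auto simp: shift_def Omega_def)

text \<open>
  The constant degrees \<open>(j,\<dots>,j)\<close>, cut off at \<open>d\<close>, exhaust \<open>d\<close>; they index the sequence that defines a concatenation.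
\<close>

lemma SUP_enat_meet:
  "(SUP j. enat (a + meet (\<lambda>_. j) d i)) = enat a + d i"
proof (rule antisym)
  show "(SUP j. enat (a + meet (\<lambda>_. j) d i)) \<le> enat a + d i"
  proof (rule SUP_least)
    fix j
    have "enat (meet (\<lambda>_. j) d i) \<le> d i" by (simp add: enat_meet)
    then show "enat (a + meet (\<lambda>_. j) d i) \<le> enat a + d i"
      by (cases "d i") auto
  qed
  have up: "enat (a + meet (\<lambda>_. j) d i) \<le> (SUP j. enat (a + meet (\<lambda>_. j) d i))" for j
    by (rule SUP_upper) simp
  show "enat a + d i \<le> (SUP j. enat (a + meet (\<lambda>_. j) d i))"
  proof (cases "d i")
    case (enat n)
    then have "meet (\<lambda>_. n) d i = n" by (simp add: meet_def)
    then show ?thesis using up [of n] enat by simp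
  next
    case infinity
    then have m: "meet (\<lambda>_. j) d i = j" for j by (simp add: meet_def)
    show ?thesis
    proof (cases "SUP j. enat (a + meet (\<lambda>_. j) d i)")
      case (enat n)
      then show ?thesis using up [of "Suc n"] m by simp
    qed simp
  qed
qed

context k_graph
begin

lemma pmor_factors:
  assumes x: "x \<in> boundary_paths \<Lambda>" and le: "p \<le> q" "q \<le> r" "emb r \<le> pdeg x"
    and g: "g \<in> Mor \<Lambda>" "h \<in> Mor \<Lambda>" "src \<Lambda> g = rng \<Lambda> h"
    and eq: "pmor x (p, r) = cmp \<Lambda> g h" and d: "deg \<Lambda> g = q - p"
  shows "pmor x (p, q) = g" "pmor x (q, r) = h"
proof -
  have q: "emb q \<le> pdeg x" using emb_le_trans [OF le(2,3)] .
  note X = pmor_in [OF x le(1) q] pmor_in [OF x le(2,3)]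
  have s: "src \<Lambda> (pmor x (p, q)) = rng \<Lambda> (pmor x (q, r))"
    using src_pmor [OF x le(1) q] rng_pmor [OF x le(2,3)] by simp
  have "cmp \<Lambda> (pmor x (p, q)) (pmor x (q, r)) = cmp \<Lambda> g h"
    using pmor_cmp [OF x le] eq by simp
  from cmp_cancel [OF X s g this] show "pmor x (p, q) = g" "pmor x (q, r) = h"
    using deg_pmor [OF x le(1) q] d by auto
qed

end

context locally_convex_k_graph
begin

text \<open>
  The concatenation is the limit of \<open>f \<cdot> x(0, (j,\<dots>,j) \<and> d(x))\<close>. The sequence grows in every direction that is
  available, because \<open>x\<close> stops only where there is no edge. Uniqueness holds since \<open>z(0, d(f) + q)\<close> is
  forced to be \<open>f \<cdot> x(0,q)\<close>; it justifies the definite description in \<open>concat_path\<close>.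
\<close>

lemma concat_path:
  assumes f: "f \<in> Mor \<Lambda>" and x: "x \<in> boundary_paths \<Lambda>" and s: "src \<Lambda> f = pobj x 0"
  defines "z \<equiv> concat_path \<Lambda> f x"
  shows "z \<in> boundary_paths \<Lambda>" "pdeg z = emb (deg \<Lambda> f) + pdeg x" "pmor z (0, deg \<Lambda> f) = f"
    "shift (deg \<Lambda> f) z = x"
proof -
  let ?df = "deg \<Lambda> f" and ?d = "pdeg x"
  define n where "n j = meet (\<lambda>_. j) ?d" for j
  have n_le: "n j \<le> n (Suc j)" "emb (n j) \<le> ?d" for j
    unfolding n_def by (rule meet_mono, simp add: le_fun_def) simp
  have cx: "cmp \<Lambda> f (pmor x (0, q)) \<in> Mor \<Lambda>" "src \<Lambda> (cmp \<Lambda> f (pmor x (0, q))) = pobj x q"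
    "deg \<Lambda> (cmp \<Lambda> f (pmor x (0, q))) = ?df + q" if q: "emb q \<le> ?d" for q
  proof -
    note X = pmor_in [OF x zero_le_mdeg q]
    have s': "src \<Lambda> f = rng \<Lambda> (pmor x (0, q))" using s rng_pmor [OF x zero_le_mdeg q] by simp
    show "cmp \<Lambda> f (pmor x (0, q)) \<in> Mor \<Lambda>" "src \<Lambda> (cmp \<Lambda> f (pmor x (0, q))) = pobj x q"
      "deg \<Lambda> (cmp \<Lambda> f (pmor x (0, q))) = ?df + q"
      using cmp_in [OF f X s'] src_cmp [OF f X s'] deg_cmp [OF f X s'] src_pmor [OF x zero_le_mdeg q]
        deg_pmor [OF x zero_le_mdeg q] by (auto simp: fun_eq_iff)
  qed
  have cxx: "cmp \<Lambda> f (pmor x (0, r)) = cmp \<Lambda> (cmp \<Lambda> f (pmor x (0, q))) (pmor x (q, r))"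
    if "q \<le> r" "emb r \<le> ?d" for q r
  proof -
    have q: "emb q \<le> ?d" using emb_le_trans [OF that] .
    show ?thesis
      using cmp_assoc [OF f pmor_in [OF x zero_le_mdeg q] pmor_in [OF x that]]
        pmor_cmp [OF x zero_le_mdeg that] rng_pmor [OF x that] src_pmor [OF x zero_le_mdeg q]
        rng_pmor [OF x zero_le_mdeg q] s by simp
  qed
  define c where "c j = cmp \<Lambda> f (pmor x (0, n j))" for j
  have deg_c: "deg \<Lambda> (c j) = ?df + n j" for j using cx(3) n_le(2) by (simp add: c_def)
  obtain y where y: "y \<in> boundary_paths \<Lambda>" "pdeg y = (\<lambda>i. SUP j. enat (deg \<Lambda> (c j) i))"
    and yc: "\<And>j. pmor y (0, deg \<Lambda> (c j)) = c j"
  proof (rule boundary_path_of_sequence [of c])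
    show "c j \<in> Mor \<Lambda>" for j using cx n_le(2) by (simp add: c_def)
    show "\<exists>h\<in>Mor \<Lambda>. src \<Lambda> (c j) = rng \<Lambda> h \<and> c (Suc j) = cmp \<Lambda> (c j) h" for j
      using cx(2) cxx n_le pmor_in [OF x n_le] rng_pmor [OF x n_le]
      by (intro bexI [of _ "pmor x (n j, n (Suc j))"]) (auto simp: c_def)
    show "\<exists>j'. deg \<Lambda> (c j) i < deg \<Lambda> (c j') i"
      if "paths_from \<Lambda> (src \<Lambda> (c j)) (unit_deg i) \<noteq> {}" for j i
    proof -
      have "src \<Lambda> (c j) = pobj x (n j)" using cx(2) n_le(2) by (simp add: c_def)
      then have "enat (n j i) \<noteq> ?d i" using boundary [OF x n_le(2)] that by auto
      then have "n j i < n (Suc j) i"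
        unfolding n_def by (cases "?d i") (auto simp: meet_def min_def split: if_splits)
      then show ?thesis by (intro exI [of _ "Suc j"]) (simp add: deg_c)
    qed
  qed blast
  have dy: "pdeg y = emb ?df + ?d"
    using y(2) by (simp add: fun_eq_iff deg_c n_def SUP_enat_meet emb_def)
  have y0: "pmor y (0, ?df + q) = cmp \<Lambda> f (pmor x (0, q))" if q: "emb q \<le> ?d" for q
  proof -
    obtain j where j: "q \<le> n j" unfolding n_def using emb_le_imp_meet_const [OF q] .
    then have *: "?df + q \<le> ?df + n j" by (simp add: le_fun_def)
    have "emb (?df + n j) \<le> pdeg y" unfolding dy emb_le_plus_iff by (rule n_le)
    from pmor_factors(1) [OF y(1) zero_le_mdeg * this cx(1) [OF q] pmor_in [OF x j n_le(2)]]
    show ?thesis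
      using cx(2,3) [OF q] rng_pmor [OF x j n_le(2)] yc [of j, unfolded deg_c, unfolded c_def]
        cxx [OF j n_le(2)] by simp
  qed
  have df: "emb ?df \<le> pdeg y" unfolding dy using emb_le_plus_iff [of ?df 0] by simp
  have f0: "pmor y (0, ?df) = f"
    using y0 [of 0] pmor_idm [OF x, of 0] cmp_idm [OF f] s by simp
  have sh: "shift ?df y = x"
  proof (rule boundary_path_eqI [OF shift_boundary_path [OF y(1) df] x])
    show eq: "pdeg (shift ?df y) = pdeg x" by (simp add: shift_sel dy)
    fix q assume "emb q \<le> pdeg (shift ?df y)"
    then have q: "emb q \<le> ?d" using eq by simp
    have q': "emb (?df + q) \<le> pdeg y" unfolding dy emb_le_plus_iff by (rule q)
    have "?df \<le> ?df + q" by (simp add: le_fun_def)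
    from pmor_factors(2) [OF y(1) zero_le_mdeg this q' f pmor_in [OF x zero_le_mdeg q]]
    have "pmor y (?df, ?df + q) = pmor x (0, q)"
      using y0 [OF q] s rng_pmor [OF x zero_le_mdeg q] by (simp add: fun_eq_iff)
    then have "pmor (shift ?df y) (0, q) = pmor x (0, q)"
      using shift_sel(3) [OF df zero_le_mdeg, of q] q' by (simp add: add.commute)
    then show "\<exists>r\<ge>q. emb r \<le> pdeg (shift ?df y) \<and> pmor (shift ?df y) (0, r) = pmor x (0, r)"
      using q eq by auto
  qed
  have uniq: "w = y" if w: "w \<in> boundary_paths \<Lambda>" "pdeg w = emb ?df + pdeg x" "pmor w (0, ?df) = f"
    "shift ?df w = x" for w
  proof (rule boundary_path_eqI [OF w(1) y(1)])
    show "pdeg w = pdeg y" using w dy by simp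
    fix q assume q: "emb q \<le> pdeg w"
    define r where "r = q - ?df"
    have r: "emb r \<le> ?d"
      unfolding emb_le_iff
    proof
      fix i show "enat (r i) \<le> ?d i"
        using q [unfolded emb_le_iff, rule_format, of i]
        by (cases "?d i") (auto simp: w(2) r_def emb_def)
    qed
    have le: "?df \<le> ?df + r" "q \<le> ?df + r" by (auto simp: le_fun_def r_def)
    have er: "emb (?df + r) \<le> pdeg w" unfolding w(2) emb_le_plus_iff by (rule r)
    have df: "emb ?df \<le> pdeg w" using emb_le_trans [OF le(1) er] .
    have "pmor w (?df, ?df + r) = pmor x (0, r)"
      using shift_sel(3) [OF df zero_le_mdeg, of r] er w(4) by (simp add: add.commute)
    then have "pmor w (0, ?df + r) = pmor y (0, ?df + r)"
      using y0 [OF r] pmor_cmp [OF w(1) zero_le_mdeg le(1) er] w(3) by simp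
    then show "\<exists>r\<ge>q. emb r \<le> pdeg w \<and> pmor w (0, r) = pmor y (0, r)"
      using le(2) er by blast
  qed
  have "z = y"
    unfolding z_def concat_path_def
  proof (rule the_equality)
    show "y \<in> boundary_paths \<Lambda> \<and> pdeg y = emb ?df + pdeg x \<and> pmor y (0, ?df) = f \<and> shift ?df y = x"
      by (intro conjI y(1) dy f0 sh)
  qed (elim conjE, rule uniq)
  then show "z \<in> boundary_paths \<Lambda>" "pdeg z = emb (deg \<Lambda> f) + pdeg x" "pmor z (0, deg \<Lambda> f) = f"
    "shift (deg \<Lambda> f) z = x"
    using y(1) dy f0 sh by auto
qed

lemma pmor_concat_path:
  assumes f: "f \<in> Mor \<Lambda>" and x: "x \<in> boundary_paths \<Lambda>" and s: "src \<Lambda> f = pobj x 0"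
    and pq: "p \<le> q" "emb q \<le> pdeg x"
  shows "pmor (concat_path \<Lambda> f x) (deg \<Lambda> f + p, deg \<Lambda> f + q) = pmor x (p, q)"
proof -
  note z = concat_path [OF f x s]
  have "emb (deg \<Lambda> f + q) \<le> pdeg (concat_path \<Lambda> f x)"
    unfolding z(2) emb_le_plus_iff by (rule pq)
  moreover from this have "emb (deg \<Lambda> f) \<le> pdeg (concat_path \<Lambda> f x)"
    by (rule emb_le_trans [rotated]) (simp add: le_fun_def)
  ultimately show ?thesis
    using shift_sel(3) [of "deg \<Lambda> f" "concat_path \<Lambda> f x" p q] z(4) pq by (simp add: add.commute)
qed

lemma ex_boundary_path_extending:
  assumes f: "f \<in> Mor \<Lambda>"
  obtains z where "z \<in> boundary_paths \<Lambda>" "emb (deg \<Lambda> f) \<le> pdeg z" "pmor z (0, deg \<Lambda> f) = f"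
proof -
  obtain x where x: "x \<in> boundary_paths \<Lambda>" "pobj x 0 = src \<Lambda> f"
    using ex_boundary_path [OF src_in [OF f]] .
  note z = concat_path [OF f x(1) x(2) [symmetric]]
  have "emb (deg \<Lambda> f) \<le> pdeg (concat_path \<Lambda> f x)"
    unfolding z(2) using emb_le_plus_iff [of "deg \<Lambda> f" 0] by simp
  then show ?thesis using that z by blast
qed

end

section \<open>Coordinates on Farthing's construction\<close>

text \<open>
  The codes are the invariants that define the two equivalence relations: two representatives are equivalent
  if and only if they have the same code. The maps \<open>vertex_of\<close> and \<open>path_of\<close> go back from codes to classes,
  and \<open>vertex_codes\<close> and \<open>path_codes\<close> are, in terms of \<open>\<Lambda>\<close> alone, the codes that occur.
\<close>

definition vertex_code :: "('v, 'a, 'k) kpath \<times> 'k mdeg \<Rightarrow> 'v \<times> 'k mdeg" where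
  "vertex_code = (\<lambda>(x, m). (pobj x (meet m (pdeg x)), m - meet m (pdeg x)))"

definition path_code ::
  "('v, 'a, 'k) kpath \<times> ('k mdeg \<times> 'k mdeg) \<Rightarrow> 'a \<times> 'k mdeg \<times> 'k mdeg" where
  "path_code = (\<lambda>(x, (m, n)).
     (pmor x (meet m (pdeg x), meet n (pdeg x)), m - meet m (pdeg x), n - m))"

definition vertex_of :: "('v, 'a, 'k) kgraph \<Rightarrow> 'v \<times> 'k mdeg \<Rightarrow> (('v, 'a, 'k) kpath \<times> 'k mdeg) set" where
  "vertex_of \<Lambda> u = {a \<in> V_pre \<Lambda>. vertex_code a = u}"

definition path_of :: "('v, 'a, 'k) kgraph \<Rightarrow> 'a \<times> 'k mdeg \<times> 'k mdeg
    \<Rightarrow> (('v, 'a, 'k) kpath \<times> ('k mdeg \<times> 'k mdeg)) set" where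
  "path_of \<Lambda> w = {a \<in> P_pre \<Lambda>. path_code a = w}"

definition vertex_codes :: "('v, 'a, 'k) kgraph \<Rightarrow> ('v \<times> 'k mdeg) set" where
  "vertex_codes \<Lambda> = {(v, t). v \<in> Obj \<Lambda> \<and> (\<forall>i. 0 < t i \<longrightarrow> paths_from \<Lambda> v (unit_deg i) = {})}"

definition path_codes :: "('v, 'a, 'k) kgraph \<Rightarrow> ('a \<times> 'k mdeg \<times> 'k mdeg) set" where
  "path_codes \<Lambda> = {(f, t, D). f \<in> Mor \<Lambda> \<and> deg \<Lambda> f \<le> D \<and>
     (\<forall>i. 0 < t i \<longrightarrow> paths_from \<Lambda> (rng \<Lambda> f) (unit_deg i) = {}) \<and>
     (\<forall>i. deg \<Lambda> f i < D i \<longrightarrow> paths_from \<Lambda> (src \<Lambda> f) (unit_deg i) = {})}"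

lemma V_class_eq: "x \<in> boundary_paths \<Lambda> \<Longrightarrow> V_class \<Lambda> x m = vertex_of \<Lambda> (vertex_code (x, m))"
  by (auto simp: V_class_def V_rel_def vertex_of_def vertex_code_def V_pre_def)

lemma P_class_eq:
  "x \<in> boundary_paths \<Lambda> \<Longrightarrow> m \<le> n \<Longrightarrow> P_class \<Lambda> x (m, n) = path_of \<Lambda> (path_code (x, (m, n)))"
  by (auto simp: P_class_def P_rel_def path_of_def path_code_def P_pre_def)

lemma boundary_meet:
  assumes "x \<in> boundary_paths \<Lambda>" and "meet m (pdeg x) i < m i"
  shows "paths_from \<Lambda> (pobj x (meet m (pdeg x))) (unit_deg i) = {}"
  using boundary [OF assms(1) emb_meet_le meet_full [OF assms(2)]] .

lemma vertex_code_in: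
  assumes "x \<in> boundary_paths \<Lambda>" shows "vertex_code (x, m) \<in> vertex_codes \<Lambda>"
  using boundary_meet [OF assms] pobj_in [OF assms emb_meet_le]
  by (simp add: vertex_codes_def vertex_code_def)

lemma path_code_in:
  assumes x: "x \<in> boundary_paths \<Lambda>" and mn: "m \<le> n"
  shows "path_code (x, (m, n)) \<in> path_codes \<Lambda>"
proof -
  let ?d = "pdeg x"
  note p = meet_mono [OF mn, of ?d] emb_meet_le [of n ?d]
  have le: "meet n ?d i - meet m ?d i \<le> n i - m i" for i
  proof -
    have "enat (meet n ?d i) = min (enat (n i)) (?d i)" "enat (meet m ?d i) = min (enat (m i)) (?d i)"
      by (simp_all add: enat_meet)
    then show ?thesis
      using mn [unfolded le_fun_def, rule_format, of i]
      by (cases "?d i") (auto simp: min_def split: if_splits)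
  qed
  have less: "meet n ?d i < n i" if "meet n ?d i - meet m ?d i < n i - m i" for i
  proof (rule ccontr)
    assume "\<not> meet n ?d i < n i"
    then have "meet n ?d i = n i" using meet_le [of n ?d] by (simp add: le_fun_def antisym)
    moreover have "meet m ?d i \<le> m i" using meet_le [of m ?d] by (simp add: le_fun_def)
    ultimately show False using that by simp
  qed
  show ?thesis
    unfolding path_codes_def path_code_def
    using boundary_meet [OF x] le less
    by (simp add: pmor_in [OF x p] rng_pmor [OF x p] src_pmor [OF x p] deg_pmor [OF x p] le_fun_def)
qed

lemma path_of_inject:
  assumes "path_of \<Lambda> u = path_of \<Lambda> w" "path_of \<Lambda> u \<noteq> {}" shows "u = w"
  using assms by (auto simp: path_of_def)

lemma UN_eq_const: "A \<noteq> {} \<Longrightarrow> (\<And>a. a \<in> A \<Longrightarrow> G a = c) \<Longrightarrow> \<Union> (G ` A) = c"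
  by auto

lemma vertex_of_inject:
  assumes "vertex_of \<Lambda> u = vertex_of \<Lambda> w" "vertex_of \<Lambda> u \<noteq> {}" shows "u = w"
  using assms by (auto simp: vertex_of_def)

context locally_convex_k_graph
begin

text \<open>
  Let \<open>z\<close> be a boundary path that starts with \<open>f\<close>. Where \<open>t\<^sub>i > 0\<close>, the range of \<open>f\<close> has no edge in direction \<open>i\<close>,
  so \<open>d(z)\<^sub>i = 0\<close> and \<open>t \<and> d(z) = 0\<close>. Where \<open>d(f)\<^sub>i < D\<^sub>i\<close>, the path \<open>z\<close> stops in direction \<open>i\<close> with \<open>f\<close>, and so
  \<open>(t + D) \<and> d(z) = d(f)\<close>. Hence \<open>(z;(t, t + D))\<close> has the given code.
\<close>

lemma obtain_path_representative:
  assumes w: "w \<in> path_codes \<Lambda>"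
  obtains z m n where "z \<in> boundary_paths \<Lambda>" "m \<le> n" "path_code (z, (m, n)) = w"
proof -
  obtain f t D where w_eq: "w = (f, t, D)" by (cases w)
  with w have f: "f \<in> Mor \<Lambda>" and D: "deg \<Lambda> f \<le> D"
    and t0: "\<And>i. 0 < t i \<Longrightarrow> paths_from \<Lambda> (rng \<Lambda> f) (unit_deg i) = {}"
    and D0: "\<And>i. deg \<Lambda> f i < D i \<Longrightarrow> paths_from \<Lambda> (src \<Lambda> f) (unit_deg i) = {}"
    by (auto simp: path_codes_def)
  obtain z where z: "z \<in> boundary_paths \<Lambda>" "emb (deg \<Lambda> f) \<le> pdeg z" "pmor z (0, deg \<Lambda> f) = f"
    using ex_boundary_path_extending [OF f] .
  \<comment> \<open>Where \<open>z\<close> continues in direction \<open>i\<close>, it provides an edge; contraposition gives \<open>dt\<close> and \<open>dD\<close> below.\<close>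
  have edge: "paths_from \<Lambda> (pobj z p) (unit_deg i) \<noteq> {}" if "emb p \<le> pdeg z" "enat (p i) < pdeg z i" for p i
  proof -
    define q where "q = p + unit_deg i"
    have le: "p \<le> q" by (simp add: le_fun_def q_def)
    have q: "emb q \<le> pdeg z"
      unfolding emb_le_iff
    proof
      fix j show "enat (q j) \<le> pdeg z j"
        using that(1) [unfolded emb_le_iff, rule_format, of j] that(2)
        by (cases "pdeg z j") (auto simp: q_def unit_deg_def)
    qed
    have "pmor z (p, q) \<in> paths_from \<Lambda> (pobj z p) (unit_deg i)"
      using pmor_in [OF z(1) le q] rng_pmor [OF z(1) le q] deg_pmor [OF z(1) le q]
      by (simp add: paths_from_def q_def fun_eq_iff)
    then show ?thesis by blast
  qed
  have r: "rng \<Lambda> f = pobj z 0" and s: "src \<Lambda> f = pobj z (deg \<Lambda> f)"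
    using rng_pmor [OF z(1) zero_le_mdeg z(2)] src_pmor [OF z(1) zero_le_mdeg z(2)] z(3) by auto
  have dt: "pdeg z i = 0" if "0 < t i" for i
    using t0 [OF that] edge [of 0 i] r by (metis emb_zero_le not_gr_zero zero_enat_def zero_fun_apply)
  have dD: "pdeg z i = enat (deg \<Lambda> f i)" if "deg \<Lambda> f i < D i" for i
    using D0 [OF that] edge [OF z(2), of i] s z(2) by (metis emb_le_iff order_le_less)
  have m: "meet t (pdeg z) = 0"
  proof
    fix i show "meet t (pdeg z) i = 0 i"
      using dt [of i] enat_meet [of t "pdeg z" i]
      by (cases "t i = 0"; cases "pdeg z i") (auto simp: zero_enat_def)
  qed
  have n: "meet (t + D) (pdeg z) = deg \<Lambda> f"
  proof
    fix i
    have "enat (deg \<Lambda> f i) \<le> pdeg z i" "deg \<Lambda> f i \<le> D i"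
      using z(2) [unfolded emb_le_iff] D [unfolded le_fun_def] by blast+
    then have "min (enat (t i + D i)) (pdeg z i) = enat (deg \<Lambda> f i)"
      using dt [of i] dD [of i] by (cases "t i = 0"; cases "deg \<Lambda> f i < D i") (auto simp: zero_enat_def min_def)
    then show "meet (t + D) (pdeg z) i = deg \<Lambda> f i"
      by (simp flip: enat_meet add: meet_def)
  qed
  have "path_code (z, (t, t + D)) = w"
    unfolding w_eq path_code_def by (simp add: m n z(3))
  then show ?thesis using that [of z t "t + D"] z(1) by (simp add: le_fun_def)
qed

text \<open>
  A vertex is the range of its identity.
\<close>

lemma obtain_vertex_representative:
  assumes u: "u \<in> vertex_codes \<Lambda>"
  obtains z m where "z \<in> boundary_paths \<Lambda>" "vertex_code (z, m) = u"
proof -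
  obtain v t where u_eq: "u = (v, t)" by (cases u)
  then have "(idm \<Lambda> v, t, 0) \<in> path_codes \<Lambda>"
    using u by (auto simp: vertex_codes_def path_codes_def idm_in rng_idm deg_idm)
  then obtain z m n where z: "z \<in> boundary_paths \<Lambda>" "m \<le> n" "path_code (z, (m, n)) = (idm \<Lambda> v, t, 0)"
    by (rule obtain_path_representative)
  then have "rng \<Lambda> (pmor z (meet m (pdeg z), meet n (pdeg z))) = v" "m - meet m (pdeg z) = t"
    using u u_eq by (auto simp: path_code_def rng_idm vertex_codes_def)
  then have "vertex_code (z, m) = u"
    using rng_pmor [OF z(1) meet_mono [OF z(2)] emb_meet_le] by (simp add: vertex_code_def u_eq)
  then show ?thesis using that z by blast
qed

lemma vertex_of_eq_iff:
  "u \<in> vertex_codes \<Lambda> \<Longrightarrow> vertex_of \<Lambda> u = vertex_of \<Lambda> w \<longleftrightarrow> u = w"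
  using vertex_of_inject obtain_vertex_representative [of u]
  by (metis (mono_tags, lifting) V_pre_def case_prodI empty_iff mem_Collect_eq vertex_of_def)

lemma path_ofD:
  assumes "(x, (m, n)) \<in> path_of \<Lambda> (f, t, D)"
  shows "x \<in> boundary_paths \<Lambda>" "m \<le> n" "pmor x (meet m (pdeg x), meet n (pdeg x)) = f"
    "m - meet m (pdeg x) = t" "n - m = D"
    "rng \<Lambda> f = pobj x (meet m (pdeg x))" "src \<Lambda> f = pobj x (meet n (pdeg x))"
    "deg \<Lambda> f = meet n (pdeg x) - meet m (pdeg x)"
proof -
  show 1: "x \<in> boundary_paths \<Lambda>" "m \<le> n" "pmor x (meet m (pdeg x), meet n (pdeg x)) = f"
    "m - meet m (pdeg x) = t" "n - m = D"
    using assms by (auto simp: path_of_def P_pre_def path_code_def)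
  note p = meet_mono [OF 1(2), of "pdeg x"] emb_meet_le [of n "pdeg x"]
  show "rng \<Lambda> f = pobj x (meet m (pdeg x))" "src \<Lambda> f = pobj x (meet n (pdeg x))"
    "deg \<Lambda> f = meet n (pdeg x) - meet m (pdeg x)"
    using rng_pmor [OF 1(1) p] src_pmor [OF 1(1) p] deg_pmor [OF 1(1) p] 1(3) by auto
qed

lemma path_of_nonempty:
  assumes "w \<in> path_codes \<Lambda>" shows "path_of \<Lambda> w \<noteq> {}"
proof -
  obtain z m n where "z \<in> boundary_paths \<Lambda>" "m \<le> n" "path_code (z, (m, n)) = w"
    using assms by (rule obtain_path_representative)
  then have "(z, (m, n)) \<in> path_of \<Lambda> w" by (simp add: path_of_def P_pre_def)
  then show ?thesis by blast
qed

lemma vertex_of_nonempty: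
  assumes "u \<in> vertex_codes \<Lambda>" shows "vertex_of \<Lambda> u \<noteq> {}"
proof -
  obtain z m where "z \<in> boundary_paths \<Lambda>" "vertex_code (z, m) = u"
    using assms by (rule obtain_vertex_representative)
  then have "(z, m) \<in> vertex_of \<Lambda> u" by (simp add: vertex_of_def V_pre_def)
  then show ?thesis by blast
qed

text \<open>
  The excess at the source of a class is the excess at its range plus the imaginary part of the degree.
\<close>

lemma src_offset:
  fixes m n :: "'k mdeg" and d :: "'k xdeg"
  assumes "m \<le> n"
  shows "n - meet n d = (m - meet m d) + (n - m - (meet n d - meet m d))"
proof
  fix i
  have "enat (meet n d i) = min (enat (n i)) (d i)" "enat (meet m d i) = min (enat (m i)) (d i)"
    by (simp_all add: enat_meet)
  then show "(n - meet n d) i = ((m - meet m d) + (n - m - (meet n d - meet m d))) i"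
    using assms [unfolded le_fun_def, rule_format, of i] by (cases "d i") (auto simp: min_def split: if_splits)
qed

lemma Obj_tilde: "Obj (tilde \<Lambda>) = vertex_of \<Lambda> ` vertex_codes \<Lambda>"
proof -
  have "Obj (tilde \<Lambda>) = (\<lambda>(x, m). V_class \<Lambda> x m) ` V_pre \<Lambda>"
    by (auto simp: tilde_def quotient_def V_class_def)
  also have "\<dots> = (\<lambda>(x, m). vertex_of \<Lambda> (vertex_code (x, m))) ` V_pre \<Lambda>"
    by (rule image_cong) (auto simp: V_pre_def V_class_eq)
  also have "\<dots> = vertex_of \<Lambda> ` vertex_codes \<Lambda>"
  proof
    show "vertex_of \<Lambda> ` vertex_codes \<Lambda> \<subseteq> (\<lambda>(x, m). vertex_of \<Lambda> (vertex_code (x, m))) ` V_pre \<Lambda>"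
    proof
      fix A assume "A \<in> vertex_of \<Lambda> ` vertex_codes \<Lambda>"
      then obtain u where u: "u \<in> vertex_codes \<Lambda>" "A = vertex_of \<Lambda> u" by blast
      obtain z m where "z \<in> boundary_paths \<Lambda>" "vertex_code (z, m) = u"
        using u(1) by (rule obtain_vertex_representative)
      then show "A \<in> (\<lambda>(x, m). vertex_of \<Lambda> (vertex_code (x, m))) ` V_pre \<Lambda>"
        using u(2) by (intro image_eqI [of _ _ "(z, m)"]) (auto simp: V_pre_def)
    qed
  qed (auto simp: V_pre_def vertex_code_in)
  finally show ?thesis .
qed

lemma Mor_tilde: "Mor (tilde \<Lambda>) = path_of \<Lambda> ` path_codes \<Lambda>"
proof -
  have "Mor (tilde \<Lambda>) = (\<lambda>(x, (m, n)). P_class \<Lambda> x (m, n)) ` P_pre \<Lambda>"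
    by (auto simp: tilde_def quotient_def P_class_def)
  also have "\<dots> = (\<lambda>(x, (m, n)). path_of \<Lambda> (path_code (x, (m, n)))) ` P_pre \<Lambda>"
    by (rule image_cong) (auto simp: P_pre_def P_class_eq)
  also have "\<dots> = path_of \<Lambda> ` path_codes \<Lambda>"
  proof
    show "path_of \<Lambda> ` path_codes \<Lambda> \<subseteq> (\<lambda>(x, (m, n)). path_of \<Lambda> (path_code (x, (m, n)))) ` P_pre \<Lambda>"
    proof
      fix A assume "A \<in> path_of \<Lambda> ` path_codes \<Lambda>"
      then obtain w where w: "w \<in> path_codes \<Lambda>" "A = path_of \<Lambda> w" by blast
      obtain z m n where "z \<in> boundary_paths \<Lambda>" "m \<le> n" "path_code (z, (m, n)) = w"
        using w(1) by (rule obtain_path_representative)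
      then show "A \<in> (\<lambda>(x, (m, n)). path_of \<Lambda> (path_code (x, (m, n)))) ` P_pre \<Lambda>"
        using w(2) by (intro image_eqI [of _ _ "(z, (m, n))"]) (auto simp: P_pre_def)
    qed
  qed (auto simp: P_pre_def path_code_in)
  finally show ?thesis .
qed

lemma rng_tilde:
  assumes w: "(f, t, D) \<in> path_codes \<Lambda>"
  shows "rng (tilde \<Lambda>) (path_of \<Lambda> (f, t, D)) = vertex_of \<Lambda> (rng \<Lambda> f, t)"
proof -
  have "(case a of (x, (m, n)) \<Rightarrow> V_class \<Lambda> x m) = vertex_of \<Lambda> (rng \<Lambda> f, t)"
    if a: "a \<in> path_of \<Lambda> (f, t, D)" for a
  proof -
    obtain x m n where [simp]: "a = (x, (m, n))" by (cases a)
    show ?thesis using path_ofD [of x m n] a by (simp add: V_class_eq vertex_code_def)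
  qed
  then show ?thesis
    unfolding tilde_def kgraph.simps by (rule UN_eq_const [OF path_of_nonempty [OF w]])
qed

lemma src_tilde:
  assumes w: "(f, t, D) \<in> path_codes \<Lambda>"
  shows "src (tilde \<Lambda>) (path_of \<Lambda> (f, t, D)) = vertex_of \<Lambda> (src \<Lambda> f, t + (D - deg \<Lambda> f))"
proof -
  have "(case a of (x, (m, n)) \<Rightarrow> V_class \<Lambda> x n) = vertex_of \<Lambda> (src \<Lambda> f, t + (D - deg \<Lambda> f))"
    if a: "a \<in> path_of \<Lambda> (f, t, D)" for a
  proof -
    obtain x m n where [simp]: "a = (x, (m, n))" by (cases a)
    show ?thesis
      using path_ofD [of x m n] a src_offset [of m n "pdeg x"] by (simp add: V_class_eq vertex_code_def)
  qed
  then show ?thesis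
    unfolding tilde_def kgraph.simps by (rule UN_eq_const [OF path_of_nonempty [OF w]])
qed

lemma deg_tilde:
  assumes w: "(f, t, D) \<in> path_codes \<Lambda>"
  shows "deg (tilde \<Lambda>) (path_of \<Lambda> (f, t, D)) = D"
proof -
  have "(\<lambda>(x, (m, n)). n - m) ` path_of \<Lambda> (f, t, D) = {D}"
    using path_of_nonempty [OF w] by (force simp: path_of_def path_code_def)
  then show ?thesis by (simp add: tilde_def)
qed

lemma idm_tilde:
  assumes u: "(v, t) \<in> vertex_codes \<Lambda>"
  shows "idm (tilde \<Lambda>) (vertex_of \<Lambda> (v, t)) = path_of \<Lambda> (idm \<Lambda> v, t, 0)"
proof -
  have "(case a of (x, m) \<Rightarrow> P_class \<Lambda> x (m, m)) = path_of \<Lambda> (idm \<Lambda> v, t, 0)"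
    if a: "a \<in> vertex_of \<Lambda> (v, t)" for a
  proof -
    obtain x m where [simp]: "a = (x, m)" by (cases a)
    have x: "x \<in> boundary_paths \<Lambda>" "vertex_code (x, m) = (v, t)"
      using a by (auto simp: vertex_of_def V_pre_def)
    have "m - m = 0" by (simp add: fun_eq_iff)
    then have "path_code (x, (m, m)) = (idm \<Lambda> v, t, 0)"
      using pmor_idm [OF x(1) emb_meet_le, of m] x(2) by (simp add: path_code_def vertex_code_def)
    then show ?thesis using x(1) by (simp add: P_class_eq)
  qed
  then show ?thesis
    unfolding tilde_def kgraph.simps by (rule UN_eq_const [OF vertex_of_nonempty [OF u]])
qed

text \<open>
  Two coordinatewise facts behind the composition: \<open>d\<close> and \<open>e\<close> are coordinates of the degrees of \<open>x\<close> and
  \<open>y\<close>, and \<open>N + (e - P)\<close> is that of the degree of the concatenation of \<open>x(0, n \<and> d(x))\<close> with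
  the shift of \<open>y\<close> by \<open>p \<and> d(y)\<close>. Equal excess at the joint means that \<open>n\<close> and \<open>p\<close>
  lie either both beyond the ends of \<open>x\<close> and \<open>y\<close>, or both within.
\<close>

lemma min_splice_left:
  fixes m n N p P :: nat and d e :: enat
  assumes "enat N = min (enat n) d" "enat P = min (enat p) e" "n - N = p - P" "m \<le> n"
  shows "min (enat m) (enat N + (e - enat P)) = min (enat m) d"
proof (cases "enat p \<le> e")
  case True
  then have "P = p" using assms(2) by (simp add: min_def)
  moreover have "N \<le> n" using assms(1) by (metis enat_ord_simps(1) min.cobounded1)
  ultimately have "N = n" using assms(3) by simp
  then have "enat n \<le> d" using assms(1) by (metis min.cobounded2)
  then have "enat m \<le> d" using assms(4) by (metis enat_ord_simps(1) order_trans)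
  moreover have "enat m \<le> enat N + (e - enat P)"
    using assms(4) \<open>N = n\<close> by (cases "e - enat P") auto
  ultimately show ?thesis by (simp add: min_absorb1)
next
  case False
  then have e: "e = enat P" using assms(2) by (simp add: min_def)
  then have "P < p" using False by simp
  then have "N \<noteq> n" using assms(3) by auto
  then have "d = enat N" using assms(1) by (auto simp: min_def split: if_splits)
  then show ?thesis using e by (simp add: zero_enat_def)
qed

lemma min_splice_right:
  fixes n N p P q Q :: nat and d e :: enat
  assumes "enat N = min (enat n) d" "enat P = min (enat p) e" "enat Q = min (enat q) e"
    "n - N = p - P" "p \<le> q"
  shows "min (enat (n + q - p)) (enat N + (e - enat P)) = enat (N + (Q - P))"
proof (cases "enat p \<le> e")
  case True
  then have "P = p" using assms(2) by (simp add: min_def)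
  moreover have "N \<le> n" using assms(1) by (metis enat_ord_simps(1) min.cobounded1)
  ultimately have "N = n" using assms(4) by simp
  show ?thesis
  proof (cases e)
    case (enat k)
    then have "Q = min q k" "p \<le> k" using assms(3) True by (auto simp: min_def split: if_splits)
    then have "min (n + q - p) (n + (k - p)) = n + (Q - p)" using assms(5) by linarith
    then show ?thesis using enat \<open>P = p\<close> \<open>N = n\<close> by simp
  next
    case infinity
    then show ?thesis using assms(3,5) \<open>P = p\<close> \<open>N = n\<close> by simp
  qed
next
  case False
  then have e: "e = enat P" using assms(2) by (simp add: min_def)
  then have "P < p" using False by simp
  then have "N \<noteq> n" using assms(4) by auto
  moreover have "N \<le> n" using assms(1) by (metis enat_ord_simps(1) min.cobounded1)
  moreover have "Q = P" using assms(3,5) e \<open>P < p\<close> by (simp add: min_def split: if_splits)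
  ultimately have "min (n + q - p) N = N + (Q - P)" using assms(5) by simp
  then show ?thesis using e by simp
qed

text \<open>
  The concatenation \<open>z\<close> first follows \<open>x\<close> up to \<open>N = n \<and> d(x)\<close> and then \<open>y\<close> from \<open>P = p \<and> d(y)\<close>. By the two
  preceding lemmas, \<open>m\<close> and \<open>n + q - p\<close> cut off at \<open>d(z)\<close> are \<open>m \<and> d(x)\<close> and \<open>N + (q \<and> d(y) - P)\<close>, so the real part of
  the composite is \<open>fg\<close>. As this depends only on the two codes, composition of classes is well defined.
\<close>

lemma path_code_concat:
  assumes x: "(x, (m, n)) \<in> path_of \<Lambda> (f, t, D)" and y: "(y, (p, q)) \<in> path_of \<Lambda> (g, s, E)"
    and fg: "src \<Lambda> f = rng \<Lambda> g" and s: "s = t + (D - deg \<Lambda> f)"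
  defines "z \<equiv> concat_path \<Lambda> (pmor x (0, meet n (pdeg x))) (shift (meet p (pdeg y)) y)"
  shows "z \<in> boundary_paths \<Lambda>" "path_code (z, (m, n + q - p)) = (cmp \<Lambda> f g, t, D + E)"
proof -
  let ?dx = "pdeg x" and ?dy = "pdeg y"
  note X = path_ofD [OF x] and Y = path_ofD [OF y]
  define N where "N = meet n ?dx"
  define P where "P = meet p ?dy"
  define Q where "Q = meet q ?dy"
  define M where "M = meet m ?dx"
  define h where "h = pmor x (0, N)"
  have PQ: "P \<le> Q" "emb Q \<le> ?dy" "emb P \<le> ?dy" and MN: "M \<le> N" "emb N \<le> ?dx" "emb M \<le> ?dx"
    unfolding P_def Q_def M_def N_def using meet_mono X(2) Y(2) by auto
  have h: "h \<in> Mor \<Lambda>" "deg \<Lambda> h = N" "src \<Lambda> h = pobj x N"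
    unfolding h_def using pmor_in [OF X(1) zero_le_mdeg MN(2)] deg_pmor [OF X(1) zero_le_mdeg MN(2)]
      src_pmor [OF X(1) zero_le_mdeg MN(2)] by (auto simp: fun_eq_iff)
  have y': "shift P y \<in> boundary_paths \<Lambda>" by (rule shift_boundary_path [OF Y(1) PQ(3)])
  have "pobj (shift P y) 0 = pobj y P" using shift_sel(2) [OF PQ(3), of 0] PQ(3) by simp
  then have hs: "src \<Lambda> h = pobj (shift P y) 0"
    using h(3) X(7) Y(6) fg by (simp add: N_def P_def)
  have z_eq: "z = concat_path \<Lambda> h (shift P y)" by (simp add: z_def h_def N_def P_def)
  note Z = concat_path [OF h(1) y' hs, folded z_eq]
  show "z \<in> boundary_paths \<Lambda>" by (rule Z)
  have off: "n - N = p - P"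
    using src_offset [OF X(2), of ?dx] X(4,5,8) Y(4) s by (simp add: N_def P_def)
  have pz: "pdeg z = emb N + (?dy - emb P)" using Z(2) h(2) shift_sel(1) by metis
  have coord: "meet m (pdeg z) i = M i \<and> meet (n + q - p) (pdeg z) i = N i + (Q i - P i)
     \<and> (n + q - p - m) i = D i + E i" for i
  proof -
    have 1: "enat (N i) = min (enat (n i)) (?dx i)" "enat (P i) = min (enat (p i)) (?dy i)"
      "enat (Q i) = min (enat (q i)) (?dy i)" "enat (M i) = min (enat (m i)) (?dx i)"
      by (simp_all add: N_def P_def Q_def M_def enat_meet)
    have 2: "m i \<le> n i" "p i \<le> q i" using X(2) Y(2) by (auto simp: le_fun_def)
    have 3: "n i - N i = p i - P i" using off by (simp add: fun_eq_iff)
    have 4: "pdeg z i = enat (N i) + (?dy i - enat (P i))" by (simp add: pz emb_def)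
    have 5: "D i = n i - m i" "E i = q i - p i" using X(5) Y(5) by auto
    have "min (enat (m i)) (pdeg z i) = enat (M i)"
      unfolding 4 1(4) by (rule min_splice_left [OF 1(1,2) 3 2(1)])
    moreover have "min (enat (n i + q i - p i)) (pdeg z i) = enat (N i + (Q i - P i))"
      unfolding 4 by (rule min_splice_right [OF 1(1-3) 3 2(2)])
    ultimately show ?thesis using 2 by (simp add: meet_def 5)
  qed
  then have mz: "meet m (pdeg z) = M" "meet (n + q - p) (pdeg z) = N + (Q - P)"
    "n + q - p - m = D + E" by (auto simp: fun_eq_iff)
  have le: "N \<le> N + (Q - P)" by (simp add: le_fun_def)
  have en: "emb (N + (Q - P)) \<le> pdeg z" using emb_meet_le mz(2) by metis
  have Nz: "emb N \<le> pdeg z" using emb_le_trans [OF le en] .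
  have "prefix (pmor x (0, N)) M = pmor x (0, M)" "pmor z (0, N) = pmor x (0, N)"
    using Z(3) h(2) prefix_suffix_cmp(1) [of "pmor x (0, M)" "pmor x (M, N)"] X(1) MN
    by (simp_all add: pmor_in rng_pmor src_pmor pmor_cmp deg_pmor h_def)
  then have f: "pmor z (M, N) = f"
    using pmor_eq_segment [OF Z(1) MN(1) order_refl Nz]
      pmor_eq_segment [OF X(1) MN(1) order_refl MN(2)] X(3) by (simp add: M_def N_def)
  have QP: "emb (Q - P) \<le> pdeg (shift P y)" "Q - P + P = Q"
  proof -
    show "Q - P + P = Q" using PQ(1) by (simp add: fun_eq_iff le_fun_def)
    then show "emb (Q - P) \<le> pdeg (shift P y)"
      using PQ by (simp add: shift_sel(1) emb_le_minus_iff)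
  qed
  have "pmor z (N, N + (Q - P)) = pmor (shift P y) (0, Q - P)"
    using pmor_concat_path [OF h(1) y' hs zero_le_mdeg QP(1)] h(2) by (simp add: z_eq)
  also have "\<dots> = g"
    using shift_sel(3) [OF PQ(3) zero_le_mdeg, of "Q - P"] QP PQ Y(3) by (simp add: P_def Q_def)
  finally have "pmor z (M, N + (Q - P)) = cmp \<Lambda> f g"
    using pmor_cmp [OF Z(1) MN(1) le en] f by simp
  then show "path_code (z, (m, n + q - p)) = (cmp \<Lambda> f g, t, D + E)"
    using mz X(4) by (simp add: path_code_def M_def)
qed

lemma cmp_tilde:
  assumes w: "(f, t, D) \<in> path_codes \<Lambda>" "(g, s, E) \<in> path_codes \<Lambda>"
    and fg: "src \<Lambda> f = rng \<Lambda> g" and s: "s = t + (D - deg \<Lambda> f)"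
  shows "cmp (tilde \<Lambda>) (path_of \<Lambda> (f, t, D)) (path_of \<Lambda> (g, s, E)) = path_of \<Lambda> (cmp \<Lambda> f g, t, D + E)"
proof -
  define F :: "('v, 'a, 'k) kpath \<times> 'k mdeg \<times> 'k mdeg \<Rightarrow> ('v, 'a, 'k) kpath \<times> 'k mdeg \<times> 'k mdeg
      \<Rightarrow> (('v, 'a, 'k) kpath \<times> 'k mdeg \<times> 'k mdeg) set"
    where "F = (\<lambda>(x, (m, n)) (y, (p, q)). P_class \<Lambda>
      (concat_path \<Lambda> (pmor x (0, meet n (pdeg x))) (shift (meet p (pdeg y)) y)) (m, n + q - p))"
  have F: "F a b = path_of \<Lambda> (cmp \<Lambda> f g, t, D + E)"
    if a: "a \<in> path_of \<Lambda> (f, t, D)" and b: "b \<in> path_of \<Lambda> (g, s, E)" for a b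
  proof -
    obtain x m n where ax: "a = (x, (m, n))" by (cases a)
    obtain y p q where bx: "b = (y, (p, q))" by (cases b)
    have "m \<le> n" "p \<le> q" using path_ofD(2) a b ax bx by blast+
    then have "m \<le> n + q - p" by (auto simp: le_fun_def intro: order_trans [OF _ le_add1] add_le_imp_le_diff add_mono)
    then show ?thesis
      using path_code_concat [OF a [unfolded ax] b [unfolded bx] fg s] by (simp add: F_def ax bx P_class_eq)
  qed
  have "cmp (tilde \<Lambda>) A B = (\<Union>a\<in>A. \<Union>b\<in>B. F a b)" for A B
    by (simp add: tilde_def F_def split_def)
  then show ?thesis
    using path_of_nonempty [OF w(1)] path_of_nonempty [OF w(2)] by (simp add: F)
qed

section \<open>Cofinality\<close>

lemma path_code_tilde:
  assumes x: "x \<in> boundary_paths \<Lambda>" and mn: "m \<le> n"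
  defines "A \<equiv> path_of \<Lambda> (path_code (x, (m, n)))"
  shows "A \<in> Mor (tilde \<Lambda>)" "rng (tilde \<Lambda>) A = vertex_of \<Lambda> (vertex_code (x, m))"
    "src (tilde \<Lambda>) A = vertex_of \<Lambda> (vertex_code (x, n))" "deg (tilde \<Lambda>) A = n - m"
proof -
  let ?d = "pdeg x"
  note p = meet_mono [OF mn, of ?d] emb_meet_le [of n ?d]
  have c: "(pmor x (meet m ?d, meet n ?d), m - meet m ?d, n - m) \<in> path_codes \<Lambda>"
    using path_code_in [OF x mn] by (simp add: path_code_def)
  show "A \<in> Mor (tilde \<Lambda>)" "rng (tilde \<Lambda>) A = vertex_of \<Lambda> (vertex_code (x, m))"
    "src (tilde \<Lambda>) A = vertex_of \<Lambda> (vertex_code (x, n))" "deg (tilde \<Lambda>) A = n - m"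
    unfolding A_def path_code_def vertex_code_def Mor_tilde
    using c rng_tilde [OF c] src_tilde [OF c] deg_tilde [OF c] src_offset [OF mn, of ?d]
    by (simp_all add: rng_pmor [OF x p] src_pmor [OF x p] deg_pmor [OF x p])
qed

text \<open>
  The path \<open>m \<mapsto> [x;m]\<close>. Being infinite, it satisfies the boundary condition vacuously.
\<close>

lemma tilde_boundary_path_of:
  assumes x: "x \<in> boundary_paths \<Lambda>"
  shows "\<lparr> pdeg = (\<lambda>_. \<infinity>), pobj = (\<lambda>m. vertex_of \<Lambda> (vertex_code (x, m))),
     pmor = (\<lambda>(m, n). if m \<le> n then path_of \<Lambda> (path_code (x, (m, n))) else undefined) \<rparr>
     \<in> boundary_paths (tilde \<Lambda>)" (is "?X \<in> _")
proof (rule boundary_pathsI)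
  let ?d = "pdeg x"
  show "degree_preserving_functor (Omega (pdeg ?X)) (tilde \<Lambda>) (pobj ?X) (pmor ?X)"
    unfolding functor_Omega_iff kpath.simps
  proof (intro conjI allI impI, goal_cases)
    case (1 p)
    show ?case unfolding Obj_tilde by (rule imageI, rule vertex_code_in [OF x])
  next
    case (2 p)
    have "p - p = 0" by (simp add: fun_eq_iff)
    then show ?case
      using idm_tilde [of "pobj x (meet p ?d)" "p - meet p ?d"] vertex_code_in [OF x, of p]
        pmor_idm [OF x emb_meet_le, of p] by (simp add: vertex_code_def path_code_def)
  next
    case (7 p q r)
    then have pq: "p \<le> q" and qr: "q \<le> r" and pr: "p \<le> r" by auto
    have add: "q - p + (r - q) = r - p"
      using pq qr by (auto simp: fun_eq_iff le_fun_def)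
    note P = meet_mono [OF pq, of ?d] emb_meet_le [of q ?d]
    note Q = meet_mono [OF qr, of ?d] emb_meet_le [of r ?d]
    have c: "(pmor x (meet p ?d, meet q ?d), p - meet p ?d, q - p) \<in> path_codes \<Lambda>"
      "(pmor x (meet q ?d, meet r ?d), q - meet q ?d, r - q) \<in> path_codes \<Lambda>"
      using path_code_in [OF x pq] path_code_in [OF x qr] by (simp_all add: path_code_def)
    show ?case
      using cmp_tilde [OF c] pq qr pr src_offset [OF pq, of ?d] pmor_cmp [OF x P(1) Q]
      by (simp add: path_code_def rng_pmor [OF x Q] src_pmor [OF x P] deg_pmor [OF x P] add)
  qed (use path_code_tilde [OF x] in simp_all)
qed (auto simp: emb_le_iff)

text \<open>
  Every vertex \<open>[z;m]\<close> has the edge \<open>[z;(m, m + e\<^sub>i)]\<close> in direction \<open>i\<close>, so no boundary path can stop.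
\<close>

lemma tilde_boundary_path_infinite:
  assumes X: "X \<in> boundary_paths (tilde \<Lambda>)"
  shows "pdeg X = (\<lambda>_. \<infinity>)"
proof
  fix i
  show "pdeg X i = \<infinity>"
  proof (rule ccontr)
    assume "pdeg X i \<noteq> \<infinity>"
    then obtain k where k: "pdeg X i = enat k" by (cases "pdeg X i") auto
    define p where "p = (\<lambda>j. if j = i then k else 0)"
    have p: "emb p \<le> pdeg X" using k by (simp add: emb_le_iff p_def zero_enat_def [symmetric])
    obtain u where u: "u \<in> vertex_codes \<Lambda>" "pobj X p = vertex_of \<Lambda> u"
      using pobj_in [OF X p] unfolding Obj_tilde by blast
    obtain z m where z: "z \<in> boundary_paths \<Lambda>" "vertex_code (z, m) = u"
      using u(1) by (rule obtain_vertex_representative)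
    have "m \<le> m + unit_deg i" "m + unit_deg i - m = unit_deg i" by (simp_all add: le_fun_def fun_eq_iff)
    then have "path_of \<Lambda> (path_code (z, (m, m + unit_deg i))) \<in> paths_from (tilde \<Lambda>) (pobj X p) (unit_deg i)"
      using path_code_tilde [OF z(1), of m "m + unit_deg i"] z(2) u(2) by (simp add: paths_from_def)
    then show False using boundary [OF X p, of i] k by (simp add: p_def)
  qed
qed

text \<open>
  Reading \<open>X\<close> in coordinates: \<open>v\<close> and \<open>t\<close> are the real vertex and the excess along \<open>X\<close>, and \<open>F m n\<close> is the real
  part of \<open>X(m,n)\<close>. The real parts compose because codes are unique.
\<close>

lemma tilde_boundary_path_coordinates:
  assumes X: "X \<in> boundary_paths (tilde \<Lambda>)"
  shows "\<exists>v t F. (\<forall>m. (v m, t m) \<in> vertex_codes \<Lambda> \<and> pobj X m = vertex_of \<Lambda> (v m, t m)) \<and>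
    (\<forall>m n. m \<le> n \<longrightarrow> (F m n, t m, n - m) \<in> path_codes \<Lambda> \<and> rng \<Lambda> (F m n) = v m \<and>
       src \<Lambda> (F m n) = v n \<and> t n = t m + (n - m - deg \<Lambda> (F m n))) \<and>
    (\<forall>m n p. m \<le> n \<longrightarrow> n \<le> p \<longrightarrow> F m p = cmp \<Lambda> (F m n) (F n p))"
proof -
  have inf: "emb m \<le> pdeg X" for m by (simp add: tilde_boundary_path_infinite [OF X] emb_le_iff)
  have "\<exists>u. u \<in> vertex_codes \<Lambda> \<and> pobj X m = vertex_of \<Lambda> u" for m
    using pobj_in [OF X inf] unfolding Obj_tilde by blast
  then obtain u where u: "\<And>m. u m \<in> vertex_codes \<Lambda>" "\<And>m. pobj X m = vertex_of \<Lambda> (u m)" by metis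
  define v t where "v = fst \<circ> u" and "t = snd \<circ> u"
  have uvt: "u m = (v m, t m)" for m by (simp add: v_def t_def)
  have "\<exists>f. m \<le> n \<longrightarrow> (f, t m, n - m) \<in> path_codes \<Lambda> \<and> rng \<Lambda> f = v m \<and> src \<Lambda> f = v n \<and>
      t n = t m + (n - m - deg \<Lambda> f) \<and> pmor X (m, n) = path_of \<Lambda> (f, t m, n - m)" for m n
  proof (cases "m \<le> n")
    case True
    obtain f s D where w: "(f, s, D) \<in> path_codes \<Lambda>" "pmor X (m, n) = path_of \<Lambda> (f, s, D)"
      using pmor_in [OF X True inf] unfolding Mor_tilde by auto
    have "vertex_of \<Lambda> (u m) = vertex_of \<Lambda> (rng \<Lambda> f, s)"
      using rng_pmor [OF X True inf] rng_tilde [OF w(1)] w(2) u(2) by metis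
    then have 1: "rng \<Lambda> f = v m" "s = t m" using vertex_of_eq_iff [OF u(1)] uvt by auto
    have 2: "D = n - m" using deg_pmor [OF X True inf] deg_tilde [OF w(1)] w(2) by metis
    have "vertex_of \<Lambda> (u n) = vertex_of \<Lambda> (src \<Lambda> f, s + (D - deg \<Lambda> f))"
      using src_pmor [OF X True inf] src_tilde [OF w(1)] w(2) u(2) by metis
    then have "src \<Lambda> f = v n" "t n = s + (D - deg \<Lambda> f)" using vertex_of_eq_iff [OF u(1)] uvt by auto
    then show ?thesis using w 1 2 by blast
  qed simp
  then obtain F where F: "\<And>m n. m \<le> n \<Longrightarrow> (F m n, t m, n - m) \<in> path_codes \<Lambda> \<and> rng \<Lambda> (F m n) = v m \<and>
      src \<Lambda> (F m n) = v n \<and> t n = t m + (n - m - deg \<Lambda> (F m n)) \<and>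
      pmor X (m, n) = path_of \<Lambda> (F m n, t m, n - m)"
    by metis
  have C: "F m p = cmp \<Lambda> (F m n) (F n p)" if mn: "m \<le> n" and np: "n \<le> p" for m n p
  proof -
    have mp: "m \<le> p" using mn np by simp
    note a = F [OF mn] and b = F [OF np] and c = F [OF mp]
    have "path_of \<Lambda> (F m p, t m, p - m) = path_of \<Lambda> (cmp \<Lambda> (F m n) (F n p), t m, n - m + (p - n))"
      using cmp_tilde [of "F m n" "t m" "n - m" "F n p" "t n" "p - n"] a b c
        pmor_cmp [OF X mn np inf] by simp
    then show ?thesis
      using path_of_inject path_of_nonempty [OF conjunct1 [OF c]] by blast
  qed
  have A: "\<forall>m. (v m, t m) \<in> vertex_codes \<Lambda> \<and> pobj X m = vertex_of \<Lambda> (v m, t m)"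
    using u uvt by simp
  have B: "\<forall>m n. m \<le> n \<longrightarrow> (F m n, t m, n - m) \<in> path_codes \<Lambda> \<and> rng \<Lambda> (F m n) = v m \<and>
       src \<Lambda> (F m n) = v n \<and> t n = t m + (n - m - deg \<Lambda> (F m n))"
  proof (intro allI impI)
    fix m n :: "'k mdeg" assume "m \<le> n"
    from F [OF this] show "(F m n, t m, n - m) \<in> path_codes \<Lambda> \<and> rng \<Lambda> (F m n) = v m \<and>
       src \<Lambda> (F m n) = v n \<and> t n = t m + (n - m - deg \<Lambda> (F m n))" by (elim conjE) (intro conjI)
  qed
  have C': "\<forall>m n p. m \<le> n \<longrightarrow> n \<le> p \<longrightarrow> F m p = cmp \<Lambda> (F m n) (F n p)"
    by (intro allI impI C)
  show ?thesis
    by (rule exI [of _ v], rule exI [of _ t], rule exI [of _ F], rule conjI [OF A conjI [OF B C']])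
qed

text \<open>
  Apply cofinality to \<open>m \<mapsto> [x;m]\<close> and the vertex \<open>(v,0)\<close>, and take the real part of the path obtained.
\<close>

lemma cofinal_if_tilde_cofinal:
  assumes cof: "cofinal_kgraph (tilde \<Lambda>)"
  shows "cofinal_kgraph \<Lambda>"
  unfolding cofinal_kgraph_def
proof (intro ballI)
  fix x v assume x: "x \<in> boundary_paths \<Lambda>" and v: "v \<in> Obj \<Lambda>"
  have v0: "(v, 0) \<in> vertex_codes \<Lambda>" using v by (simp add: vertex_codes_def)
  then have "vertex_of \<Lambda> (v, 0) \<in> Obj (tilde \<Lambda>)" unfolding Obj_tilde by (rule imageI)
  then obtain n A where A: "A \<in> Mor (tilde \<Lambda>)" "rng (tilde \<Lambda>) A = vertex_of \<Lambda> (v, 0)"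
    "src (tilde \<Lambda>) A = vertex_of \<Lambda> (vertex_code (x, n))"
    using cof tilde_boundary_path_of [OF x] unfolding cofinal_kgraph_def by fastforce
  then obtain f t D where w: "(f, t, D) \<in> path_codes \<Lambda>" "A = path_of \<Lambda> (f, t, D)"
    unfolding Mor_tilde by auto
  have "vertex_of \<Lambda> (v, 0) = vertex_of \<Lambda> (rng \<Lambda> f, t)"
    using A(2) rng_tilde [OF w(1)] w(2) by simp
  then have "rng \<Lambda> f = v" unfolding vertex_of_eq_iff [OF v0] by simp
  moreover have "vertex_of \<Lambda> (vertex_code (x, n)) = vertex_of \<Lambda> (src \<Lambda> f, t + (D - deg \<Lambda> f))"
    using A(3) src_tilde [OF w(1)] w(2) by simp
  then have "src \<Lambda> f = pobj x (meet n (pdeg x))"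
    unfolding vertex_of_eq_iff [OF vertex_code_in [OF x]] by (simp add: vertex_code_def)
  ultimately have "f \<in> {f \<in> Mor \<Lambda>. rng \<Lambda> f = v \<and> src \<Lambda> f = pobj x (meet n (pdeg x))}"
    using w(1) by (simp add: path_codes_def)
  then show "\<exists>n. emb n \<le> pdeg x \<and> {f \<in> Mor \<Lambda>. rng \<Lambda> f = v \<and> src \<Lambda> f = pobj x n} \<noteq> {}"
    using emb_meet_le by blast
qed

text \<open>
  Apply cofinality to the limit of the real parts of \<open>X\<close>, move on along \<open>X\<close> to a point with large enough
  excess, and lift.
\<close>

lemma tilde_cofinal_if_cofinal:
  assumes cof: "cofinal_kgraph \<Lambda>"
  shows "cofinal_kgraph (tilde \<Lambda>)"
  unfolding cofinal_kgraph_def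
proof (intro ballI)
  fix X V assume X: "X \<in> boundary_paths (tilde \<Lambda>)" and V: "V \<in> Obj (tilde \<Lambda>)"
  obtain w s where w: "(w, s) \<in> vertex_codes \<Lambda>" "V = vertex_of \<Lambda> (w, s)"
    using V unfolding Obj_tilde by auto
  obtain v t F where vt0: "\<forall>m. (v m, t m) \<in> vertex_codes \<Lambda> \<and> pobj X m = vertex_of \<Lambda> (v m, t m)"
    and F0: "\<forall>m n. m \<le> n \<longrightarrow> (F m n, t m, n - m) \<in> path_codes \<Lambda> \<and> rng \<Lambda> (F m n) = v m \<and>
       src \<Lambda> (F m n) = v n \<and> t n = t m + (n - m - deg \<Lambda> (F m n))"
    and F_cmp0: "\<forall>m n p. m \<le> n \<longrightarrow> n \<le> p \<longrightarrow> F m p = cmp \<Lambda> (F m n) (F n p)"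
    using tilde_boundary_path_coordinates [OF X] by (elim exE conjE) (rule that)
  have vt: "(v m, t m) \<in> vertex_codes \<Lambda>" "pobj X m = vertex_of \<Lambda> (v m, t m)" for m
    using vt0 by blast+
  note F = F0 [rule_format] and F_cmp = F_cmp0 [rule_format]
  have F_Mor: "F m n \<in> Mor \<Lambda>" if "m \<le> n" for m n using F [OF that] by (simp add: path_codes_def)
  define J :: "nat \<Rightarrow> 'k mdeg" where "J j = (\<lambda>_. j)" for j
  have J: "J j \<le> J (Suc j)" for j by (simp add: J_def le_fun_def)
  define c where "c j = F 0 (J j)" for j
  have c: "c j \<in> Mor \<Lambda>" "src \<Lambda> (c j) = v (J j)" for j
    using F_Mor F by (simp_all add: c_def)
  have step: "src \<Lambda> (c j) = rng \<Lambda> (F (J j) (J (Suc j)))" "c (Suc j) = cmp \<Lambda> (c j) (F (J j) (J (Suc j)))" for j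
    using F [OF J] c(2) F_cmp [OF zero_le_mdeg J] by (simp_all add: c_def)
  obtain z where z: "z \<in> boundary_paths \<Lambda>" "pdeg z = (\<lambda>i. SUP j. enat (deg \<Lambda> (c j) i))"
    "\<And>j. pmor z (0, deg \<Lambda> (c j)) = c j" "\<And>q. emb q \<le> pdeg z \<Longrightarrow> \<exists>j. q \<le> deg \<Lambda> (c j)"
  proof (rule boundary_path_of_sequence [of c])
    show "\<exists>h\<in>Mor \<Lambda>. src \<Lambda> (c j) = rng \<Lambda> h \<and> c (Suc j) = cmp \<Lambda> (c j) h" for j
      using step F_Mor [OF J] by blast
    show "\<exists>j'. deg \<Lambda> (c j) i < deg \<Lambda> (c j') i"
      if e: "paths_from \<Lambda> (src \<Lambda> (c j)) (unit_deg i) \<noteq> {}" for j i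
    proof -
      let ?h = "F (J j) (J (Suc j))"
      \<comment> \<open>Otherwise \<open>X\<close> makes an imaginary step here, although a real edge is available.\<close>
      have "deg \<Lambda> ?h i \<noteq> 0"
      proof
        assume 0: "deg \<Lambda> ?h i = 0"
        then have "deg \<Lambda> ?h i < (J (Suc j) - J j) i" by (simp add: J_def)
        then have "paths_from \<Lambda> (src \<Lambda> ?h) (unit_deg i) = {}"
          using conjunct1 [OF F [OF J [of j]]] unfolding path_codes_def by blast
        then show False using edge_transport [OF F_Mor [OF J] 0] e step(1) by simp
      qed
      then show ?thesis
        using step deg_cmp [OF c(1) F_Mor [OF J] step(1)] by (intro exI [of _ "Suc j"]) simp
    qed
  qed (use c in blast)+
  have zc: "emb (deg \<Lambda> (c j)) \<le> pdeg z" for j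
    unfolding z(2) emb_le_iff by (auto intro: SUP_upper)
  have "w \<in> Obj \<Lambda>" using w(1) by (simp add: vertex_codes_def)
  then obtain p g where p: "emb p \<le> pdeg z" and g: "g \<in> Mor \<Lambda>" "rng \<Lambda> g = w" "src \<Lambda> g = pobj z p"
    using cof z(1) unfolding cofinal_kgraph_def by blast
  obtain j where j: "p \<le> deg \<Lambda> (c j)" using z(4) [OF p] by blast
  \<comment> \<open>Where \<open>s\<^sub>i > 0\<close>, all \<open>s\<^sub>i\<close> steps of \<open>X\<close> from \<open>J j\<close> to \<open>N\<close> in direction \<open>i\<close> are imaginary, whence \<open>s \<le> t N\<close>.\<close>
  define N where "N = J j + s"
  have JN: "J j \<le> N" "N - J j = s" by (simp_all add: N_def le_fun_def fun_eq_iff)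
  let ?b = "pmor z (p, deg \<Lambda> (c j))" and ?h = "F (J j) N"
  have b: "?b \<in> Mor \<Lambda>" "src \<Lambda> g = rng \<Lambda> ?b" "src \<Lambda> ?b = v (J j)"
    using pmor_in [OF z(1) j zc] rng_pmor [OF z(1) j zc] src_pmor [OF z(1) j zc] g(3)
      src_pmor [OF z(1) zero_le_mdeg zc] z(3) c(2) by metis+
  define a where "a = cmp \<Lambda> g ?b"
  have a: "a \<in> Mor \<Lambda>" "rng \<Lambda> a = w" "src \<Lambda> a = rng \<Lambda> ?h"
    using cmp_in [OF g(1) b(1,2)] rng_cmp [OF g(1) b(1,2)] src_cmp [OF g(1) b(1,2)] g b(3) F [OF JN(1)]
    by (simp_all add: a_def)
  define f where "f = cmp \<Lambda> a ?h"
  have f: "f \<in> Mor \<Lambda>" "rng \<Lambda> f = w" "src \<Lambda> f = v N"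
    using cmp_in [OF a(1) F_Mor [OF JN(1)] a(3)] rng_cmp [OF a(1) F_Mor [OF JN(1)] a(3)]
      src_cmp [OF a(1) F_Mor [OF JN(1)] a(3)] a F [OF JN(1)] by (simp_all add: f_def)
  have s0: "paths_from \<Lambda> w (unit_deg i) = {}" if "0 < s i" for i
    using w(1) that by (simp add: vertex_codes_def)
  have "s i \<le> t N i" for i
  proof (cases "s i = 0")
    case False
    then have "paths_from \<Lambda> (src \<Lambda> a) (unit_deg i) = {}"
      using s0 [of i] edge_back [OF a(1)] a(2) by auto
    then have "deg \<Lambda> ?h i = 0"
      using edge_of_deg_pos [OF F_Mor [OF JN(1)], of i] a(3) by auto
    moreover have "t N = t (J j) + (s - deg \<Lambda> ?h)" using F [OF JN(1)] JN(2) by simp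
    ultimately show ?thesis by simp
  qed simp
  then have sN: "s + (t N - s) = t N" by (simp add: fun_eq_iff)
  \<comment> \<open>The degree for which \<open>(f, s, D)\<close> has source \<open>(v N, t N)\<close>: the imaginary part makes up the difference of the excesses.\<close>
  define D where "D = deg \<Lambda> f + (t N - s)"
  have Df: "D - deg \<Lambda> f = t N - s" by (simp add: D_def fun_eq_iff)
  have "paths_from \<Lambda> (v N) (unit_deg i) = {}" if "deg \<Lambda> f i < D i" for i
    using vt(1) [of N] that by (auto simp: vertex_codes_def D_def)
  then have code: "(f, s, D) \<in> path_codes \<Lambda>"
    using f s0 by (simp add: path_codes_def) (simp add: D_def le_fun_def)
  have "path_of \<Lambda> (f, s, D) \<in> {A \<in> Mor (tilde \<Lambda>). rng (tilde \<Lambda>) A = V \<and> src (tilde \<Lambda>) A = pobj X N}"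
    using rng_tilde [OF code] src_tilde [OF code] code f w(2) vt(2) Df sN by (simp add: Mor_tilde)
  moreover have "emb N \<le> pdeg X" by (simp add: tilde_boundary_path_infinite [OF X] emb_le_iff)
  ultimately show "\<exists>n. emb n \<le> pdeg X \<and>
      {A \<in> Mor (tilde \<Lambda>). rng (tilde \<Lambda>) A = V \<and> src (tilde \<Lambda>) A = pobj X n} \<noteq> {}"
    by blast
qed

end

theorem proposition3p5:
  fixes \<Lambda> :: "('v, 'a, 'k::finite) kgraph"
  assumes "k_graph \<Lambda>"
    and "row_finite \<Lambda>"
    and "locally_convex \<Lambda>"
  shows "cofinal_kgraph \<Lambda> \<longleftrightarrow> cofinal_kgraph (tilde \<Lambda>)"
proof -
  interpret locally_convex_k_graph \<Lambda>
    using assms by (simp add: locally_convex_k_graph_def locally_convex_k_graph_axioms_def)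
  show ?thesis using cofinal_if_tilde_cofinal tilde_cofinal_if_cofinal by blast
qed

end
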